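(* Fix an integer $r\ge 3$. Let $p=p(n)\in[0,1]$ and a non-negative integer $s=s(n)$ satisfy $$n^{-2/r}(\log n)^{1/\binom r2}\ll p\ll n^{-2/(r+1)},\qquad n-s\in r\mathbb Z,\qquad s=o(n).$$ Then $$\mathbb P\bigl(\phi_r^s(G(n,p))=0\bigr)=\exp\!\left(-\Theta_r\!\left((s+1)\frac{\mu_r}{n}\right)\right).$$
   Context: All asymptotics are as $n\to\infty$; $f\ll g$ means $f/g\to0$. $G(n,p)$ is the binomial random graph on $[n]$. $\Theta_r(\cdot)$ denotes a quantity bounded above and below by positive constants depending only on $r$ times its argument, for all sufficiently large $n$. For a graph $G$ on $n$ vertices and an integer $0\le s\le n$ with $n-s\in r\mathbb Z$, $\phi_r^s(G)$ denotes the number of collections of $(n-s)/r$ pairwise vertex-disjoint copies of $K_r$ in $G$ (i.e. $K_r$-matchings covering exactly $n-s$ vertices). Also $\mu_r=\mu_r(n,p):=\binom nr p^{\binom r2}$. *)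

theory Defs
  imports "HOL-Probability.Probability" "HOL-Library.Ramsey" "HOL-Library.Landau_Symbols"
begin

text \<open>A finite simple graph is a pair of a vertex set \<open>V\<close> and an edge set
  \<open>E \<subseteq> [V]\<^bsup>2\<^esup>\<close>, edges being two-element sets of vertices.\<close>

type_synonym 'a ugraph = "'a set \<times> 'a set set"

definition binomial_random_graph :: "nat \<Rightarrow> real \<Rightarrow> nat ugraph pmf" where
  "binomial_random_graph n p =
     map_pmf (\<lambda>present. ({1..n}, {e \<in> [{1..n}]\<^bsup>2\<^esup>. present e}))
       (Pi_pmf ([{1..n}]\<^bsup>2\<^esup>) False (\<lambda>_. bernoulli_pmf p))"

text \<open>A copy of \<open>K\<^sub>r\<close> in a simple graph is determined by its vertex set,
  so copies are represented by vertex sets of size \<open>r\<close> spanning a clique.\<close>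

definition K_copies :: "nat \<Rightarrow> 'a ugraph \<Rightarrow> 'a set set" where
  "K_copies r G = {K \<in> [fst G]\<^bsup>r\<^esup>. clique K (snd G)}"

text \<open>Meaningful for \<open>s \<le> |V|\<close> and \<open>r\<close> dividing \<open>|V| - s\<close>
  (natural-number subtraction and division).\<close>

definition phi :: "nat \<Rightarrow> nat \<Rightarrow> 'a ugraph \<Rightarrow> nat" where
  "phi r s G = card {M. M \<subseteq> K_copies r G \<and> disjoint M \<and> card M = (card (fst G) - s) div r}"

definition mu :: "nat \<Rightarrow> nat \<Rightarrow> real \<Rightarrow> real" where
  "mu r n p = real (n choose r) * p ^ (r choose 2)"

end

theory Submission
  imports Defs
begin

text \<open>
  Write \<open>m = r choose 2\<close> and \<open>\<lambda> = n^(r-1) p^m\<close>, which is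
  \<open>\<mu>_r/n\<close> up to a constant depending on \<open>r\<close>. Put
  \<open>a = (n - s)/r\<close>, \<open>l = n div r\<close> and \<open>q = l - a + 1\<close>;
  then \<open>r q\<close> is at least \<open>s + 1\<close>, so on the logarithmic scale the claim is that
  no \<open>a\<close> disjoint copies of \<open>K_r\<close> exist with probability
  \<open>exp (- \<Theta>(q \<lambda>))\<close>.

  That the probability is not smaller follows from Harris' inequality: with probability at least
  \<open>exp (- 2 r (s + 1) \<mu>_r/n)\<close> no vertex of a fixed set of \<open>s + 1\<close>
  vertices lies in a copy of \<open>K_r\<close>, and then no matching covers \<open>n - s\<close> vertices
  (\<open>uncovered_bound\<close>).

  The upper bound on the probability has two independent parts.

  \<^emph>\<open>From graphs to hypergraphs\<close> (\<open>clique_comparison\<close>). Below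
  \<open>n^(-2/(r+1))\<close> a copy of \<open>K_r\<close> rarely shares an edge with another one, so the
  copies should behave like the edges of a binomial \<open>r\<close>-uniform hypergraph of density
  \<open>p^m\<close>, in which distinct \<open>r\<close>-sets are independent. For the event at hand this
  becomes an inequality without error term: the failure probability in \<open>G(n,p)\<close> is at most the
  one in the hypergraph of density \<open>p^m/4\<close>. One interpolates: edges have probability
  \<open>t\<close>, hyperedges probability \<open>(p^m - t^m)/4\<close>, and \<open>t\<close> runs from
  \<open>0\<close> to \<open>p\<close>. By Russo's formula the failure probability does not increase along
  the way if pivotal edges are sufficiently numerous compared with pivotal \<open>r\<close>-sets. Planting a
  clique on a pivotal \<open>r\<close>-set \<open>K\<close> makes all its \<open>m\<close> edges pivotal,
  unless planting \<open>K\<close> creates a second clique that shares an edge with \<open>K\<close>. The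
  latter case is rare even conditionally on \<open>K\<close> being pivotal
  (\<open>pivotal_not_clean\<close>): take the canonical matching \<open>M\<close> that \<open>K\<close>
  completes; the edges of the second clique that join different blocks of \<open>M\<close> can be deleted
  without affecting \<open>M\<close> or the pivotality of \<open>K\<close>, and there are so many of them
  that the expected number of such second cliques tends to \<open>0\<close> (\<open>sum_crossing\<close>).

  \<^emph>\<open>Matchings in the binomial hypergraph\<close> (\<open>bad_after_rounds\<close>,
  \<open>hypergraph_bound\<close>). The hypergraph contains the union of \<open>\<Omega>(\<lambda>)\<close>
  independent rounds, each of constant average degree. Start with all \<open>l\<close>-matchings
  \<open>F\<close>, of which only a fraction \<open>(O(1)/n^(r-1))^|T|\<close> contains any given set
  \<open>T\<close> (\<open>matchings_spread\<close>). After each round replace the part of \<open>F\<close>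
  that is still missing by a minimal part that can be completed with the help of the hyperedges just seen.
  The minimality lets one reconstruct the missing part from the union of itself with the round, at the price
  of a bounded number of choices per hyperedge, so that the \<open>q\<close>-th moment of its size,
  restricted to failure, shrinks by \<open>3^(-q)\<close> in every round. On failure the size never drops
  below \<open>q\<close>, so failure after \<open>k\<close> rounds has probability at most
  \<open>(n 3^(-k))^q\<close>. Since \<open>\<lambda>\<close> is much larger than \<open>ln n\<close>, a
  number \<open>k\<close> of rounds of order \<open>\<lambda>\<close> gives
  \<open>exp (- \<Omega>(q \<lambda>))\<close>.
\<close>

section \<open>Product Bernoulli measures on subsets of a finite set\<close>

definition bern_weight :: "'a set \<Rightarrow> ('a \<Rightarrow> real) \<Rightarrow> 'a set \<Rightarrow> real" where
  "bern_weight I q X = (\<Prod>i\<in>I. if i \<in> X then q i else 1 - q i)"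

text \<open>The expectation of \<open>g\<close> at the random subset of \<open>I\<close> that contains each
\<open>i\<close> independently with probability \<open>q i\<close>. A finite sum makes it a polynomial in
the probabilities, which is what the interpolation argument differentiates.\<close>

definition bern_exp :: "'a set \<Rightarrow> ('a \<Rightarrow> real) \<Rightarrow> ('a set \<Rightarrow> real) \<Rightarrow> real" where
  "bern_exp I q g = (\<Sum>X\<in>Pow I. bern_weight I q X * g X)"

lemma bern_weight_nonneg: "(\<And>i. i \<in> I \<Longrightarrow> 0 \<le> q i \<and> q i \<le> 1) \<Longrightarrow> 0 \<le> bern_weight I q X"
  unfolding bern_weight_def by (intro prod_nonneg) auto

lemma bern_exp_empty [simp]: "bern_exp {} q g = g {}"
  by (simp add: bern_exp_def bern_weight_def)

lemma bern_exp_insert: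
  assumes "finite I" "j \<notin> I"
  shows "bern_exp (insert j I) q g =
    (1 - q j) * bern_exp I q g + q j * bern_exp I q (\<lambda>X. g (insert j X))"
proof -
  have inj: "inj_on (insert j) (Pow I)"
    using assms(2) by (auto simp: inj_on_def)
  have disj: "Pow I \<inter> insert j ` Pow I = {}" using assms(2) by auto
  have w1: "bern_weight (insert j I) q X = (1 - q j) * bern_weight I q X" if "X \<in> Pow I" for X
    using that assms by (auto simp: bern_weight_def)
  have w2: "bern_weight (insert j I) q (insert j X) = q j * bern_weight I q X" if "X \<in> Pow I" for X
  proof -
    have "(\<Prod>i\<in>I. if i \<in> insert j X then q i else 1 - q i) = (\<Prod>i\<in>I. if i \<in> X then q i else 1 - q i)"
      using assms(2) by (intro prod.cong) auto
    then show ?thesis using assms by (simp add: bern_weight_def)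
  qed
  have "bern_exp (insert j I) q g = (\<Sum>X\<in>Pow I. bern_weight (insert j I) q X * g X)
      + (\<Sum>X\<in>insert j ` Pow I. bern_weight (insert j I) q X * g X)"
    unfolding bern_exp_def Pow_insert using assms disj by (intro sum.union_disjoint) auto
  also have "(\<Sum>X\<in>insert j ` Pow I. bern_weight (insert j I) q X * g X)
      = (\<Sum>X\<in>Pow I. bern_weight (insert j I) q (insert j X) * g (insert j X))"
    using sum.reindex[OF inj] by simp
  finally show ?thesis
    unfolding bern_exp_def sum_distrib_left using w1 w2 by (simp add: mult.assoc)
qed

lemma bern_exp_add: "bern_exp I q (\<lambda>X. f X + g X) = bern_exp I q f + bern_exp I q g"
  by (simp add: bern_exp_def algebra_simps sum.distrib)

lemma bern_exp_diff: "bern_exp I q (\<lambda>X. f X - g X) = bern_exp I q f - bern_exp I q g"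
  by (simp add: bern_exp_def algebra_simps sum_subtractf)

lemma bern_exp_cmult: "bern_exp I q (\<lambda>X. c * f X) = c * bern_exp I q f"
  by (simp add: bern_exp_def sum_distrib_left algebra_simps)

lemma bern_exp_sum: "bern_exp I q (\<lambda>X. \<Sum>j\<in>J. f j X) = (\<Sum>j\<in>J. bern_exp I q (f j))"
  unfolding bern_exp_def sum_distrib_left by (rule sum.swap)

lemma bern_exp_cong: "(\<And>X. X \<subseteq> I \<Longrightarrow> f X = g X) \<Longrightarrow> bern_exp I q f = bern_exp I q g"
  unfolding bern_exp_def by (intro sum.cong) auto

lemma bern_exp_mono:
  assumes "\<And>i. i \<in> I \<Longrightarrow> 0 \<le> q i \<and> q i \<le> 1" "\<And>X. X \<subseteq> I \<Longrightarrow> f X \<le> g X"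
  shows "bern_exp I q f \<le> bern_exp I q g"
  unfolding bern_exp_def
  by (intro sum_mono mult_left_mono bern_weight_nonneg) (use assms in auto)

lemma bern_exp_nonneg:
  assumes "\<And>i. i \<in> I \<Longrightarrow> 0 \<le> q i \<and> q i \<le> 1" "\<And>X. X \<subseteq> I \<Longrightarrow> 0 \<le> f X"
  shows "0 \<le> bern_exp I q f"
  unfolding bern_exp_def
  by (intro sum_nonneg mult_nonneg_nonneg bern_weight_nonneg) (use assms in auto)

lemma bern_exp_const: "finite I \<Longrightarrow> bern_exp I q (\<lambda>_. c) = c"
proof (induction I rule: finite_induct)
  case (insert j I)
  then show ?case by (simp add: bern_exp_insert algebra_simps)
qed simp

text \<open>Two decreasing functions are positively correlated: by induction on the coordinates, the
one-coordinate case being \<open>0 \<le> (a - b) (c - d)\<close> for the conditional expectations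
\<open>a, b\<close> and \<open>c, d\<close>.\<close>

lemma harris_inequality:
  assumes "finite I" "\<And>i. i \<in> I \<Longrightarrow> 0 \<le> q i \<and> q i \<le> 1"
    and "\<And>X Y. X \<subseteq> Y \<Longrightarrow> Y \<subseteq> I \<Longrightarrow> f Y \<le> f X"
    and "\<And>X Y. X \<subseteq> Y \<Longrightarrow> Y \<subseteq> I \<Longrightarrow> g Y \<le> g X"
  shows "bern_exp I q f * bern_exp I q g \<le> bern_exp I q (\<lambda>X. f X * g X)"
  using assms
proof (induction I arbitrary: f g rule: finite_induct)
  case (insert j I)
  have q: "0 \<le> q i \<and> q i \<le> 1" if "i \<in> I" for i using insert.prems(1) that by auto
  have qj: "0 \<le> q j" "q j \<le> 1" using insert.prems(1) by auto
  let ?f1 = "\<lambda>X. f (insert j X)" and ?g1 = "\<lambda>X. g (insert j X)"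
  define a b c d where "a = bern_exp I q f" and "b = bern_exp I q ?f1" and "c = bern_exp I q g" and "d = bern_exp I q ?g1"
  have "b \<le> a" unfolding a_def b_def
    by (intro bern_exp_mono q insert.prems(2)) auto
  moreover have "d \<le> c" unfolding c_def d_def
    by (intro bern_exp_mono q insert.prems(3)) auto
  ultimately have "0 \<le> (a - b) * (c - d)" by simp
  then have "0 \<le> (q j * (1 - q j)) * ((a - b) * (c - d))" using qj by (simp add: mult_nonneg_nonneg)
  then have 1: "((1 - q j) * a + q j * b) * ((1 - q j) * c + q j * d) \<le> (1 - q j) * (a * c) + q j * (b * d)"
    by (simp add: algebra_simps)
  have "a * c \<le> bern_exp I q (\<lambda>X. f X * g X)"
    unfolding a_def c_def by (intro insert.IH q insert.prems(2,3)) auto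
  moreover have "b * d \<le> bern_exp I q (\<lambda>X. ?f1 X * ?g1 X)"
    unfolding b_def d_def by (intro insert.IH q insert.prems(2,3)) auto
  ultimately have "(1 - q j) * (a * c) + q j * (b * d) \<le>
    (1 - q j) * bern_exp I q (\<lambda>X. f X * g X) + q j * bern_exp I q (\<lambda>X. ?f1 X * ?g1 X)"
    using qj by (intro add_mono mult_left_mono) auto
  with 1 show ?case using insert.hyps by (simp add: bern_exp_insert a_def b_def c_def d_def)
qed simp

text \<open>Exposing a random set in two independent rounds; iterating it splits a random hypergraph into
many sparse rounds.\<close>

lemma bern_exp_union:
  assumes "finite I"
  shows "bern_exp I a (\<lambda>X. bern_exp I b (\<lambda>Y. g (X \<union> Y))) = bern_exp I (\<lambda>i. a i + b i - a i * b i) g"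
  using assms
proof (induction I arbitrary: g rule: finite_induct)
  case (insert j I)
  have 1: "bern_exp I b (\<lambda>Y. g (insert j X \<union> Y)) = bern_exp I b (\<lambda>Y. g (insert j (X \<union> Y)))"
     "bern_exp I b (\<lambda>Y. g (X \<union> insert j Y)) = bern_exp I b (\<lambda>Y. g (insert j (X \<union> Y)))"
     "bern_exp I b (\<lambda>Y. g (insert j X \<union> insert j Y)) = bern_exp I b (\<lambda>Y. g (insert j (X \<union> Y)))" for X
    by (simp_all add: insert_absorb2)
  show ?case
    using insert.hyps insert.IH[of g] insert.IH[of "\<lambda>X. g (insert j X)"]
    by (simp add: bern_exp_insert 1 bern_exp_add bern_exp_cmult) (simp add: algebra_simps)
qed simp

lemma bern_exp_antimono:
  assumes "finite I" "\<And>i. i \<in> I \<Longrightarrow> 0 \<le> a i \<and> a i \<le> b i \<and> b i \<le> 1"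
    and "\<And>X Y. X \<subseteq> Y \<Longrightarrow> Y \<subseteq> I \<Longrightarrow> g Y \<le> g X"
  shows "bern_exp I b g \<le> bern_exp I a g"
  using assms
proof (induction I arbitrary: g rule: finite_induct)
  case (insert j I)
  have ab: "0 \<le> a i \<and> a i \<le> b i \<and> b i \<le> 1" if "i \<in> insert j I" for i using insert.prems(1) that by auto
  let ?g1 = "\<lambda>X. g (insert j X)"
  have 1: "bern_exp I b g \<le> bern_exp I a g" by (intro insert.IH ab insert.prems(2)) auto
  have 2: "bern_exp I b ?g1 \<le> bern_exp I a ?g1" by (intro insert.IH ab insert.prems(2)) auto
  have 3: "bern_exp I a ?g1 \<le> bern_exp I a g"
  proof (rule bern_exp_mono)
    show "0 \<le> a i \<and> a i \<le> 1" if "i \<in> I" for i using ab[of i] that by auto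
  qed (intro insert.prems(2), auto)
  have "(1 - b j) * bern_exp I b g + b j * bern_exp I b ?g1 \<le> (1 - b j) * bern_exp I a g + b j * bern_exp I a ?g1"
    using ab[of j] 1 2 by (intro add_mono mult_left_mono) auto
  also have "\<dots> \<le> (1 - a j) * bern_exp I a g + a j * bern_exp I a ?g1"
  proof -
    have "(b j - a j) * bern_exp I a ?g1 \<le> (b j - a j) * bern_exp I a g" using ab[of j] 3 by (intro mult_left_mono) auto
    then show ?thesis by (simp add: algebra_simps)
  qed
  finally show ?case using insert.hyps by (simp add: bern_exp_insert)
qed simp

lemma bern_exp_coord:
  assumes "finite I" "k \<in> I" "\<And>X. X \<subseteq> I \<Longrightarrow> f (insert k X) = f X"
  shows "bern_exp I q (\<lambda>X. of_bool (k \<in> X) * f X) = q k * bern_exp I q f"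
    and "bern_exp I q (\<lambda>X. of_bool (k \<notin> X) * f X) = (1 - q k) * bern_exp I q f"
proof -
  obtain J where J: "I = insert k J" "k \<notin> J" "finite J"
    using assms(1,2) by (metis Set.set_insert finite_insert)
  have 1: "bern_exp J q (\<lambda>X. f (insert k X)) = bern_exp J q f"
    by (intro bern_exp_cong assms(3)) (auto simp: J)
  have 2: "bern_exp J q (\<lambda>X. of_bool (k \<in> X) * f X) = 0" "bern_exp J q (\<lambda>X. of_bool (k \<notin> X) * f X) = bern_exp J q f"
  proof -
    have "bern_exp J q (\<lambda>X. of_bool (k \<in> X) * f X) = bern_exp J q (\<lambda>X. 0)"
      by (intro bern_exp_cong) (use J in auto)
    then show "bern_exp J q (\<lambda>X. of_bool (k \<in> X) * f X) = 0" using bern_exp_const[OF J(3)] by simp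
    show "bern_exp J q (\<lambda>X. of_bool (k \<notin> X) * f X) = bern_exp J q f"
      by (intro bern_exp_cong) (use J in auto)
  qed
  show "bern_exp I q (\<lambda>X. of_bool (k \<in> X) * f X) = q k * bern_exp I q f"
    unfolding J(1) bern_exp_insert[OF J(3,2)] using 1 2 by (simp add: algebra_simps)
  have "bern_exp J q (\<lambda>_. 0) = 0" using bern_exp_const[OF J(3)] by simp
  then show "bern_exp I q (\<lambda>X. of_bool (k \<notin> X) * f X) = (1 - q k) * bern_exp I q f"
    unfolding J(1) bern_exp_insert[OF J(3,2)] using 1 2 by (simp add: algebra_simps)
qed

lemma bern_exp_subset_indep:
  assumes "finite I" "D \<subseteq> I" "\<And>X d. X \<subseteq> I \<Longrightarrow> d \<in> D \<Longrightarrow> f (insert d X) = f X"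
  shows "bern_exp I q (\<lambda>X. of_bool (D \<subseteq> X) * f X) = (\<Prod>d\<in>D. q d) * bern_exp I q f"
proof -
  have "finite D" using assms finite_subset by blast
  then show ?thesis using assms(2,3)
  proof (induction D rule: finite_induct)
    case (insert d D)
    have "bern_exp I q (\<lambda>X. of_bool (insert d D \<subseteq> X) * f X) =
       bern_exp I q (\<lambda>X. of_bool (d \<in> X) * (of_bool (D \<subseteq> X) * f X))"
      by (intro bern_exp_cong) auto
    also have "\<dots> = q d * bern_exp I q (\<lambda>X. of_bool (D \<subseteq> X) * f X)"
    proof (rule bern_exp_coord(1)[OF assms(1)])
      show "d \<in> I" using insert by auto
      fix X assume "X \<subseteq> I"
      then show "of_bool (D \<subseteq> insert d X) * f (insert d X) = of_bool (D \<subseteq> X) * f X"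
        using insert.hyps insert.prems(2)[of X d] by auto
    qed
    also have "\<dots> = q d * ((\<Prod>d\<in>D. q d) * bern_exp I q f)"
      using insert by (subst insert.IH) auto
    finally show ?case using insert.hyps by simp
  qed simp
qed

lemma bern_weight_split:
  assumes "finite I" "D \<subseteq> I" "Y \<inter> D = {}"
  shows "bern_weight I q (Y \<union> D) = (\<Prod>d\<in>D. q d) * bern_weight (I - D) q Y"
    and "bern_weight I q Y = (\<Prod>d\<in>D. 1 - q d) * bern_weight (I - D) q Y"
proof -
  have fin: "finite D" using assms finite_subset by blast
  have I: "I = D \<union> (I - D)" using assms by auto
  have "bern_weight I q (Y \<union> D) = (\<Prod>i\<in>D. if i \<in> Y \<union> D then q i else 1 - q i) * (\<Prod>i\<in>I-D. if i \<in> Y \<union> D then q i else 1 - q i)"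
    unfolding bern_weight_def by (subst I, subst prod.union_disjoint) (use assms fin in auto)
  also have "\<dots> = (\<Prod>d\<in>D. q d) * bern_weight (I - D) q Y"
    unfolding bern_weight_def by (intro arg_cong2[where f="(*)"] prod.cong) auto
  finally show "bern_weight I q (Y \<union> D) = (\<Prod>d\<in>D. q d) * bern_weight (I - D) q Y" .
  have "bern_weight I q Y = (\<Prod>i\<in>D. if i \<in> Y then q i else 1 - q i) * (\<Prod>i\<in>I-D. if i \<in> Y then q i else 1 - q i)"
    unfolding bern_weight_def by (subst I, subst prod.union_disjoint) (use assms fin in auto)
  also have "\<dots> = (\<Prod>d\<in>D. 1 - q d) * bern_weight (I - D) q Y"
    unfolding bern_weight_def by (intro arg_cong2[where f="(*)"] prod.cong) (use assms in auto)
  finally show "bern_weight I q Y = (\<Prod>d\<in>D. 1 - q d) * bern_weight (I - D) q Y" .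
qed

text \<open>Deleting \<open>D\<close> from the sets that contain it is injective and changes the weight of a
set by the product of the odds of the elements of \<open>D\<close>. So if \<open>f\<close> survives the
deletion, requiring \<open>D\<close> to be present costs almost as much as it does unconditionally.\<close>

lemma bern_exp_delete:
  assumes "finite I" "D \<subseteq> I" "\<And>i. i \<in> I \<Longrightarrow> 0 \<le> q i \<and> q i \<le> 1"
    and "\<And>d. d \<in> D \<Longrightarrow> q d \<le> x * (1 - q d)" "0 \<le> x"
    and "\<And>X. X \<subseteq> I \<Longrightarrow> D \<subseteq> X \<Longrightarrow> f X \<le> f (X - D)" "\<And>X. X \<subseteq> I \<Longrightarrow> 0 \<le> f X"
  shows "bern_exp I q (\<lambda>X. of_bool (D \<subseteq> X) * f X) \<le> x ^ card D * bern_exp I q f"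
proof -
  have fin: "finite D" using assms finite_subset by blast
  have "bern_exp I q (\<lambda>X. of_bool (D \<subseteq> X) * f X) = (\<Sum>X\<in>{X. X \<subseteq> I \<and> D \<subseteq> X}. bern_weight I q X * f X)"
    unfolding bern_exp_def by (rule sum.mono_neutral_cong_right) (use assms in auto)
  also have "\<dots> \<le> (\<Sum>X\<in>{X. X \<subseteq> I \<and> D \<subseteq> X}. x ^ card D * (bern_weight I q (X - D) * f (X - D)))"
  proof (rule sum_mono)
    fix X assume X: "X \<in> {X. X \<subseteq> I \<and> D \<subseteq> X}"
    have "bern_weight I q X = (\<Prod>d\<in>D. q d) * bern_weight (I - D) q (X - D)"
    proof -
      have "X - D \<union> D = X" using X by auto
      then show ?thesis using bern_weight_split(1)[OF assms(1,2), of "X - D" q] by (metis Diff_disjoint Int_commute)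
    qed
    also have "\<dots> \<le> (\<Prod>d\<in>D. x * (1 - q d)) * bern_weight (I - D) q (X - D)"
      by (intro mult_right_mono prod_mono bern_weight_nonneg) (use assms in auto)
    also have "\<dots> = x ^ card D * bern_weight I q (X - D)"
    proof -
      have "(X - D) \<inter> D = {}" by auto
      from bern_weight_split(2)[OF assms(1,2) this, of q] show ?thesis by (simp add: prod.distrib mult.assoc)
    qed
    finally have 1: "bern_weight I q X \<le> x ^ card D * bern_weight I q (X - D)" .
    have "bern_weight I q X * f X \<le> (x ^ card D * bern_weight I q (X - D)) * f (X - D)"
      using 1 assms(6)[of X] assms(7)[of X] X
      by (intro mult_mono) (auto intro!: mult_nonneg_nonneg bern_weight_nonneg zero_le_power simp: assms(3,5))
    then show "bern_weight I q X * f X \<le> x ^ card D * (bern_weight I q (X - D) * f (X - D))" by (simp add: mult.assoc)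
  qed
  also have "\<dots> = (\<Sum>Y\<in>(\<lambda>X. X - D) ` {X. X \<subseteq> I \<and> D \<subseteq> X}. x ^ card D * (bern_weight I q Y * f Y))"
    by (subst sum.reindex) (auto simp: inj_on_def)
  also have "\<dots> \<le> (\<Sum>Y\<in>Pow I. x ^ card D * (bern_weight I q Y * f Y))"
  proof (rule sum_mono2)
    show "finite (Pow I)" using assms by auto
    show "(\<lambda>X. X - D) ` {X. X \<subseteq> I \<and> D \<subseteq> X} \<subseteq> Pow I" by auto
    fix Y assume "Y \<in> Pow I - (\<lambda>X. X - D) ` {X. X \<subseteq> I \<and> D \<subseteq> X}"
    then show "0 \<le> x ^ card D * (bern_weight I q Y * f Y)"
      using assms by (intro mult_nonneg_nonneg bern_weight_nonneg zero_le_power) auto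
  qed
  also have "\<dots> = x ^ card D * bern_exp I q f" by (simp add: bern_exp_def sum_distrib_left)
  finally show ?thesis .
qed

text \<open>The expectation is affine in each coordinate probability, the slope being the influence of that
coordinate; the chain rule gives the derivative along a curve of probability vectors.\<close>

lemma russo_formula:
  assumes "finite I" "\<And>i. i \<in> I \<Longrightarrow> ((\<lambda>t. Q t i) has_real_derivative q' i) (at t)"
  shows "((\<lambda>t. bern_exp I (Q t) g) has_real_derivative
    (\<Sum>i\<in>I. q' i * bern_exp I (Q t) (\<lambda>X. g (insert i X) - g (X - {i})))) (at t)"
  using assms
proof (induction I arbitrary: g rule: finite_induct)
  case (insert j I)
  let ?g1 = "\<lambda>X. g (insert j X)"
  let ?d = "\<lambda>g. \<Sum>i\<in>I. q' i * bern_exp I (Q t) (\<lambda>X. g (insert i X) - g (X - {i}))"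
  have d0: "((\<lambda>t. Q t j) has_real_derivative q' j) (at t)" using insert.prems by auto
  have d1: "((\<lambda>t. bern_exp I (Q t) g) has_real_derivative ?d g) (at t)"
    "((\<lambda>t. bern_exp I (Q t) ?g1) has_real_derivative ?d ?g1) (at t)"
    by (intro insert.IH; use insert.prems in auto)+
  have e: "(\<lambda>t. bern_exp (insert j I) (Q t) g) = (\<lambda>t. (1 - Q t j) * bern_exp I (Q t) g + Q t j * bern_exp I (Q t) ?g1)"
    using insert.hyps by (simp add: bern_exp_insert fun_eq_iff)
  have "((\<lambda>t. (1 - Q t j) * bern_exp I (Q t) g + Q t j * bern_exp I (Q t) ?g1) has_real_derivative
      ((- q' j) * bern_exp I (Q t) g + (1 - Q t j) * ?d g) + (q' j * bern_exp I (Q t) ?g1 + Q t j * ?d ?g1)) (at t)"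
    by (rule derivative_eq_intros d0 d1 refl | simp)+
  moreover have "(\<Sum>i\<in>insert j I. q' i * bern_exp (insert j I) (Q t) (\<lambda>X. g (insert i X) - g (X - {i})))
     = ((- q' j) * bern_exp I (Q t) g + (1 - Q t j) * ?d g) + (q' j * bern_exp I (Q t) ?g1 + Q t j * ?d ?g1)"
  proof -
    have c: "bern_exp I (Q t) (\<lambda>X. g (insert j X) - g (X - {j})) = bern_exp I (Q t) (\<lambda>X. g (insert j X) - g X)"
      "bern_exp I (Q t) (\<lambda>X. g (insert j (insert j X)) - g (insert j X - {j})) = bern_exp I (Q t) (\<lambda>X. g (insert j X) - g X)"
      by (intro bern_exp_cong; use insert.hyps in \<open>auto simp: subset_iff intro!: arg_cong[where f=g]\<close>)+
    have c2: "bern_exp I (Q t) (\<lambda>X. g (insert i (insert j X)) - g (insert j X - {i}))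
       = bern_exp I (Q t) (\<lambda>X. g (insert j (insert i X)) - g (insert j (X - {i})))" if "i \<in> I" for i
    proof -
      have "i \<noteq> j" using that insert.hyps by auto
      then show ?thesis by (simp add: insert_commute insert_Diff_if)
    qed
    have "q' j * bern_exp (insert j I) (Q t) (\<lambda>X. g (insert j X) - g (X - {j}))
      = q' j * (bern_exp I (Q t) ?g1 - bern_exp I (Q t) g)"
      unfolding bern_exp_insert[OF insert.hyps] c by (simp add: bern_exp_diff algebra_simps)
    moreover have "(\<Sum>i\<in>I. q' i * bern_exp (insert j I) (Q t) (\<lambda>X. g (insert i X) - g (X - {i})))
      = (1 - Q t j) * ?d g + Q t j * ?d ?g1"
    proof -
      have "(\<Sum>i\<in>I. q' i * bern_exp (insert j I) (Q t) (\<lambda>X. g (insert i X) - g (X - {i})))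
        = (\<Sum>i\<in>I. (1 - Q t j) * (q' i * bern_exp I (Q t) (\<lambda>X. g (insert i X) - g (X - {i})))
         + Q t j * (q' i * bern_exp I (Q t) (\<lambda>X. g (insert j (insert i X)) - g (insert j (X - {i})))))"
        by (intro sum.cong refl) (simp add: bern_exp_insert[OF insert.hyps] c2 algebra_simps)
      then show ?thesis by (simp add: sum.distrib sum_distrib_left)
    qed
    ultimately show ?thesis using insert.hyps by (simp add: algebra_simps)
  qed
  ultimately show ?case unfolding e by simp
qed simp

lemma bern_exp_zero_coords:
  assumes "finite I" "finite J" "I \<inter> J = {}" "\<And>i. i \<in> J \<Longrightarrow> q i = 0"
  shows "bern_exp (I \<union> J) q g = bern_exp I q g"
  using assms(2,3,4)
proof (induction J rule: finite_induct)
  case (insert j J)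
  then show ?case using assms(1) by (simp add: bern_exp_insert)
qed simp

lemma bern_exp_union_bound:
  assumes "\<And>i. i \<in> I \<Longrightarrow> 0 \<le> q i \<and> q i \<le> 1" "finite J"
    and "\<And>X. X \<subseteq> I \<Longrightarrow> P X \<Longrightarrow> \<exists>j\<in>J. A j X"
  shows "bern_exp I q (\<lambda>X. of_bool (P X)) \<le> (\<Sum>j\<in>J. bern_exp I q (\<lambda>X. of_bool (A j X)))"
proof -
  have "bern_exp I q (\<lambda>X. of_bool (P X)) \<le> bern_exp I q (\<lambda>X. \<Sum>j\<in>J. of_bool (A j X))"
  proof (rule bern_exp_mono[OF assms(1)])
    fix X assume X: "X \<subseteq> I"
    show "of_bool (P X) \<le> (\<Sum>j\<in>J. of_bool (A j X) :: real)"
    proof (cases "P X")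
      case True
      then obtain j where j: "j \<in> J" "A j X" using assms(3) X by blast
      have "of_bool (A j X) \<le> (\<Sum>j\<in>J. of_bool (A j X) :: real)"
        by (rule member_le_sum) (use j assms(2) in auto)
      then show ?thesis using j by simp
    qed (simp add: sum_nonneg)
  qed
  then show ?thesis by (simp add: bern_exp_sum)
qed

lemma prob_Pi_bernoulli:
  assumes I: "finite I" and p: "0 \<le> p" "p \<le> 1"
  shows "measure_pmf.prob (Pi_pmf I False (\<lambda>_. bernoulli_pmf p)) {f. Q {i \<in> I. f i}}
    = bern_exp I (\<lambda>_. p) (\<lambda>X. of_bool (Q X))"
proof -
  let ?M = "Pi_pmf I False (\<lambda>_. bernoulli_pmf p)"
  define g where "g = (\<lambda>X i. i \<in> (X :: 'a set))"
  have inj: "inj_on g A" for A by (auto simp: inj_on_def g_def fun_eq_iff)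
  have supp: "set_pmf ?M \<subseteq> g ` Pow I"
  proof
    fix f assume "f \<in> set_pmf ?M"
    then have "f i = False" if "i \<notin> I" for i
      using set_Pi_pmf_subset[OF I, of False "\<lambda>_. bernoulli_pmf p"] that by blast
    then have "f = g {i. f i}" "{i. f i} \<in> Pow I" by (auto simp: g_def)
    then show "f \<in> g ` Pow I" by blast
  qed
  have pm: "pmf ?M (g X) = bern_weight I (\<lambda>_. p) X" if "X \<subseteq> I" for X
  proof -
    have "pmf ?M (g X) = (\<Prod>i\<in>I. pmf (bernoulli_pmf p) (g X i))"
      by (rule pmf_Pi') (use I that in \<open>auto simp: g_def\<close>)
    also have "\<dots> = bern_weight I (\<lambda>_. p) X"
      unfolding bern_weight_def by (intro prod.cong) (use p in \<open>auto simp: g_def\<close>)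
    finally show ?thesis .
  qed
  have Xg: "{i \<in> I. g X i} = X" if "X \<subseteq> I" for X using that by (auto simp: g_def)
  have "measure_pmf.prob ?M {f. Q {i \<in> I. f i}} = measure_pmf.prob ?M (g ` {X. X \<subseteq> I \<and> Q X})"
  proof (rule measure_prob_cong_0)
    fix f assume f: "f \<in> {f. Q {i \<in> I. f i}} - g ` {X. X \<subseteq> I \<and> Q X}"
    have "f \<notin> g ` Pow I"
    proof
      assume "f \<in> g ` Pow I"
      then obtain X where X: "X \<subseteq> I" "f = g X" by auto
      then have "Q X" using f Xg[OF X(1)] by simp
      then show False using X f by auto
    qed
    then show "pmf ?M f = 0" using supp by (auto simp: set_pmf_eq)
  next
    fix f assume "f \<in> g ` {X. X \<subseteq> I \<and> Q X} - {f. Q {i \<in> I. f i}}"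
    then show "pmf ?M f = 0" using Xg by auto
  qed
  also have "\<dots> = (\<Sum>f\<in>g ` {X. X \<subseteq> I \<and> Q X}. pmf ?M f)"
    by (rule measure_measure_pmf_finite) (use I in auto)
  also have "\<dots> = (\<Sum>X\<in>{X. X \<subseteq> I \<and> Q X}. bern_weight I (\<lambda>_. p) X)"
    unfolding sum.reindex[OF inj] by (intro sum.cong) (auto simp: pm)
  also have "\<dots> = bern_exp I (\<lambda>_. p) (\<lambda>X. of_bool (Q X))"
    unfolding bern_exp_def by (rule sum.mono_neutral_cong_left) (use I in auto)
  finally show ?thesis .
qed

text \<open>The counterpart of \<open>bern_exp_delete\<close>: planting a set \<open>T\<close> that is
disjoint from the random set costs at most a factor \<open>h\<close> per element. An event that can be
recognised after planting \<open>T\<close> is therefore charged to the unconditioned measure.\<close>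

lemma bern_exp_plant:
  assumes "finite I" "T \<subseteq> I" "0 \<le> h" "h \<le> 1" "\<And>X. X \<subseteq> I \<Longrightarrow> 0 \<le> f X"
  shows "h ^ card T * bern_exp I (\<lambda>_. h) (\<lambda>X. of_bool (T \<inter> X = {}) * f (X \<union> T)) \<le> bern_exp I (\<lambda>_. h) f"
proof -
  let ?P = "{X. X \<subseteq> I \<and> T \<inter> X = {}}"
  have "bern_exp I (\<lambda>_. h) (\<lambda>X. of_bool (T \<inter> X = {}) * f (X \<union> T)) = (\<Sum>X\<in>?P. bern_weight I (\<lambda>_. h) X * f (X \<union> T))"
    unfolding bern_exp_def by (rule sum.mono_neutral_cong_right) (use assms in auto)
  then have "h ^ card T * bern_exp I (\<lambda>_. h) (\<lambda>X. of_bool (T \<inter> X = {}) * f (X \<union> T))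
     = (\<Sum>X\<in>?P. (h ^ card T * bern_weight I (\<lambda>_. h) X) * f (X \<union> T))"
    by (simp add: sum_distrib_left mult.assoc)
  also have "\<dots> \<le> (\<Sum>X\<in>?P. bern_weight I (\<lambda>_. h) (X \<union> T) * f (X \<union> T))"
  proof (intro sum_mono mult_right_mono)
    fix X assume X: "X \<in> ?P"
    then have d: "X \<inter> T = {}" by auto
    have w: "0 \<le> bern_weight (I - T) (\<lambda>_. h) X" by (intro bern_weight_nonneg) (use assms in auto)
    have "bern_weight I (\<lambda>_. h) X = (1 - h) ^ card T * bern_weight (I - T) (\<lambda>_. h) X"
      using bern_weight_split(2)[OF assms(1,2) d, of "\<lambda>_. h"] by simp
    also have "\<dots> \<le> 1 * bern_weight (I - T) (\<lambda>_. h) X"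
      by (intro mult_right_mono power_le_one w) (use assms in auto)
    finally have "h ^ card T * bern_weight I (\<lambda>_. h) X \<le> h ^ card T * bern_weight (I - T) (\<lambda>_. h) X"
      by (intro mult_left_mono) (use assms in auto)
    also have "\<dots> = bern_weight I (\<lambda>_. h) (X \<union> T)"
      using bern_weight_split(1)[OF assms(1,2) d, of "\<lambda>_. h"] by simp
    finally show "h ^ card T * bern_weight I (\<lambda>_. h) X \<le> bern_weight I (\<lambda>_. h) (X \<union> T)" .
    show "0 \<le> f (X \<union> T)" using X assms by auto
  qed
  also have "\<dots> = (\<Sum>Z\<in>(\<lambda>X. X \<union> T) ` ?P. bern_weight I (\<lambda>_. h) Z * f Z)"
    by (subst sum.reindex) (auto simp: inj_on_def)
  also have "\<dots> \<le> bern_exp I (\<lambda>_. h) f"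
    unfolding bern_exp_def
    by (rule sum_mono2) (use assms in \<open>auto intro!: mult_nonneg_nonneg bern_weight_nonneg\<close>)
  finally show ?thesis .
qed

section \<open>Fragments of spread families in independent random rounds\<close>

lemma geometric_tail:
  fixes x :: real
  assumes "0 \<le> x" "x \<le> 1 / 2"
  shows "(\<Sum>t=q..M. x ^ t) \<le> 2 * x ^ q"
proof (cases "q \<le> M")
  case True
  have s: "0 \<le> (\<Sum>t=q..M. x ^ t)" using assms by (intro sum_nonneg) auto
  have "(1/2) * (\<Sum>t=q..M. x ^ t) \<le> (1 - x) * (\<Sum>t=q..M. x ^ t)"
    using assms s by (intro mult_right_mono) auto
  also have "\<dots> = x ^ q - x ^ Suc M" using True by (rule sum_gp_multiplied)
  also have "\<dots> \<le> x ^ q" using assms by simp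
  finally show ?thesis by simp
qed (use assms in simp)

text \<open>\<open>S F\<close> is the part of \<open>F\<close> that is still missing before the round
\<open>W\<close>. After it one may switch from \<open>F\<close> to any \<open>F'\<close> whose missing part
lies in \<open>W \<union> S F\<close>; among those that are not larger, the fragment is a smallest
remainder. The bound on the size is what makes the reconstruction in \<open>fragment_count\<close>
cheap.\<close>

definition candidates :: "'f set \<Rightarrow> ('f \<Rightarrow> 'a set) \<Rightarrow> 'a set \<Rightarrow> 'f \<Rightarrow> 'f set" where
  "candidates \<F> S W F = {F' \<in> \<F>. S F' \<subseteq> W \<union> S F \<and> card (S F') \<le> card (S F)}"

definition fragment :: "'f set \<Rightarrow> ('f \<Rightarrow> 'a set) \<Rightarrow> 'a set \<Rightarrow> 'f \<Rightarrow> 'a set" where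
  "fragment \<F> S W F = S (arg_min_on (\<lambda>F'. card (S F' - W)) (candidates \<F> S W F)) - W"

text \<open>A family of sets \<open>A F\<close> such that a random member contains a given \<open>T\<close>
with probability at most \<open>\<sigma>^|T|\<close>, together with the density \<open>h\<close> of one
round. The ratio \<open>\<sigma>/h\<close> measures how useful a round is.\<close>

locale spread_family =
  fixes R :: "'a set" and \<F> :: "'f set" and A :: "'f \<Rightarrow> 'a set" and \<sigma> h :: real
  assumes finR: "finite R" and finF: "finite \<F>" and neF: "\<F> \<noteq> {}"
    and h: "0 < h" "h \<le> 1" and \<sigma>: "0 \<le> \<sigma>"
    and A: "\<And>F. F \<in> \<F> \<Longrightarrow> A F \<subseteq> R"
    and spread: "\<And>T. T \<subseteq> R \<Longrightarrow> real (card {F \<in> \<F>. T \<subseteq> A F}) \<le> \<sigma> ^ card T * real (card \<F>)"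
begin

lemma fragment_obtain:
  assumes "F \<in> \<F>"
  obtains F' where "F' \<in> \<F>" "S F' \<subseteq> W \<union> S F" "card (S F') \<le> card (S F)"
    "fragment \<F> S W F = S F' - W" "\<And>F''. F'' \<in> candidates \<F> S W F \<Longrightarrow> card (S F' - W) \<le> card (S F'' - W)"
proof -
  let ?c = "candidates \<F> S W F" and ?f = "\<lambda>F'. card (S F' - W)"
  have c: "finite ?c" "?c \<noteq> {}" using assms finF by (auto simp: candidates_def)
  define F' where "F' = arg_min_on ?f ?c"
  have "F' \<in> ?c" "\<not> (\<exists>x\<in>?c. ?f x < ?f F')"
    using arg_min_if_finite[OF c, of ?f] by (auto simp: F'_def)
  then show thesis by (intro that[of F']) (auto simp: candidates_def fragment_def F'_def not_less)
qed

lemma fragment_subset: "F \<in> \<F> \<Longrightarrow> fragment \<F> S W F \<subseteq> S F"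
  by (rule fragment_obtain[of F S W]) auto

text \<open>Encode a pair \<open>(F, W)\<close> with fragment \<open>T\<close> by the union
\<open>Z = W \<union> T\<close>. From \<open>Z\<close> alone one determines a smallest
\<open>S G\<close> inside \<open>Z\<close>, and minimality of the fragment forces
\<open>T \<subseteq> S G\<close>, where \<open>S G\<close> has at most \<open>N\<close> elements: there
are at most \<open>N choose t\<close> choices for \<open>T\<close>. Passing from \<open>W\<close> to
\<open>Z\<close> costs \<open>h^(-t)\<close>, and spreadness saves \<open>\<sigma>^t\<close> in the choice
of \<open>F\<close>.\<close>

lemma fragment_count:
  assumes S: "\<And>F. F \<in> \<F> \<Longrightarrow> S F \<subseteq> A F"
  shows "(\<Sum>F\<in>\<F>. bern_exp R (\<lambda>_. h) (\<lambda>W. of_bool (card (fragment \<F> S W F) = t \<and> card (S F) \<le> N)))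
    \<le> real (card \<F>) * (\<sigma> / h) ^ t * real (N choose t)"
proof -
  \<comment> \<open>a function of \<open>Z\<close> only, so that it can be evaluated after planting\<close>
  define smallest where "smallest Z = arg_min_on (\<lambda>F. card (S F)) {F \<in> \<F>. S F \<subseteq> Z}" for Z
  define good where "good Z T \<longleftrightarrow> {F \<in> \<F>. S F \<subseteq> Z} \<noteq> {} \<and> T \<subseteq> S (smallest Z) \<and> card (S (smallest Z)) \<le> N \<and> card T = t"
    for Z T
  define TT where "TT = {T. T \<subseteq> R \<and> card T = t}"
  have finTT: "finite TT" unfolding TT_def using finR by auto
  have smallest: "smallest Z \<in> \<F> \<and> S (smallest Z) \<subseteq> Z \<and> (\<forall>F\<in>\<F>. S F \<subseteq> Z \<longrightarrow> card (S (smallest Z)) \<le> card (S F))"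
    if "{F \<in> \<F>. S F \<subseteq> Z} \<noteq> {}" for Z
    using arg_min_if_finite[of "{F \<in> \<F>. S F \<subseteq> Z}" "\<lambda>F. card (S F)"] that finF
    unfolding smallest_def[symmetric] by (auto simp: not_less)
  have finS: "finite (S F)" if "F \<in> \<F>" for F
    using S[OF that] A[OF that] finR by (meson finite_subset)
  have key: "good (W \<union> T) T \<and> T \<inter> W = {} \<and> T \<subseteq> A F \<and> T \<in> TT"
    if prem: "F \<in> \<F>" "T = fragment \<F> S W F" "card T = t" "card (S F) \<le> N" for F W T
  proof -
    obtain F' where F': "F' \<in> \<F>" "S F' \<subseteq> W \<union> S F" "card (S F') \<le> card (S F)"
      "fragment \<F> S W F = S F' - W" "\<And>F''. F'' \<in> candidates \<F> S W F \<Longrightarrow> card (S F' - W) \<le> card (S F'' - W)"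
      using fragment_obtain[OF prem(1)] by metis
    have T: "T = S F' - W" using F' prem by simp
    have ne: "F' \<in> {F \<in> \<F>. S F \<subseteq> W \<union> T}" using F' T by auto
    define G where "G = smallest (W \<union> T)"
    have G: "G \<in> \<F>" "S G \<subseteq> W \<union> T" "card (S G) \<le> card (S F')"
      using smallest[of "W \<union> T"] ne unfolding G_def by auto
    \<comment> \<open>\<open>G\<close> competes with \<open>F'\<close> in the choice of the fragment and cannot win\<close>
    have sub: "S G - W \<subseteq> T" using G by auto
    have "G \<in> candidates \<F> S W F" unfolding candidates_def
      using G F' T by auto
    then have "card T \<le> card (S G - W)" using F'(5) T by auto
    with sub have "S G - W = T"
      using finS[OF F'(1)] T by (intro card_seteq) auto
    then have "T \<subseteq> S G" by auto
    moreover have "card (S G) \<le> N" using G F' prem by linarith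
    moreover have "T \<subseteq> S F" using T F' by auto
    ultimately show ?thesis
      using ne S[OF prem(1)] A[OF prem(1)] prem(3) T unfolding good_def G_def TT_def by blast
  qed
  let ?b = "\<lambda>T. bern_exp R (\<lambda>_. h) (\<lambda>W. of_bool (T \<inter> W = {}) * of_bool (good (W \<union> T) T))"
  have bnn: "0 \<le> ?b T" for T by (intro bern_exp_nonneg) (use h in auto)
  have "(\<Sum>F\<in>\<F>. bern_exp R (\<lambda>_. h) (\<lambda>W. of_bool (card (fragment \<F> S W F) = t \<and> card (S F) \<le> N)))
     \<le> (\<Sum>F\<in>\<F>. bern_exp R (\<lambda>_. h) (\<lambda>W. \<Sum>T\<in>TT. of_bool (T \<subseteq> A F) * (of_bool (T \<inter> W = {}) * of_bool (good (W \<union> T) T))))"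
  proof (intro sum_mono bern_exp_mono)
    fix F W assume F: "F \<in> \<F>"
    let ?g = "\<lambda>T. of_bool (T \<subseteq> A F) * (of_bool (T \<inter> W = {}) * of_bool (good (W \<union> T) T)) :: real"
    show "of_bool (card (fragment \<F> S W F) = t \<and> card (S F) \<le> N) \<le> (\<Sum>T\<in>TT. ?g T)"
    proof (cases "card (fragment \<F> S W F) = t \<and> card (S F) \<le> N")
      case True
      note k = key[OF F refl, of W] True
      have "?g (fragment \<F> S W F) \<le> (\<Sum>T\<in>TT. ?g T)"
        by (rule member_le_sum) (use k finTT in auto)
      then show ?thesis using k by auto
    next
      case False
      then have "of_bool (card (fragment \<F> S W F) = t \<and> card (S F) \<le> N) = (0::real)" by (simp only: of_bool_eq)
      then show ?thesis by (simp only:) (intro sum_nonneg, auto)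
    qed
  qed (use h in auto)
  also have "\<dots> = (\<Sum>F\<in>\<F>. \<Sum>T\<in>TT. of_bool (T \<subseteq> A F) * ?b T)"
    by (simp add: bern_exp_sum bern_exp_cmult)
  also have "\<dots> = (\<Sum>T\<in>TT. \<Sum>F\<in>\<F>. of_bool (T \<subseteq> A F) * ?b T)"
    by (rule sum.swap)
  also have "\<dots> = (\<Sum>T\<in>TT. real (card {F\<in>\<F>. T \<subseteq> A F}) * ?b T)"
    by (intro sum.cong refl) (use finF in \<open>simp add: sum_distrib_right[symmetric] Int_def\<close>)
  also have "\<dots> \<le> (\<Sum>T\<in>TT. (real (card \<F>) * (\<sigma> / h) ^ t) * (h ^ card T * ?b T))"
  proof (intro sum_mono)
    fix T assume T: "T \<in> TT"
    have "real (card {F\<in>\<F>. T \<subseteq> A F}) * ?b T \<le> (\<sigma> ^ t * real (card \<F>)) * ?b T"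
      using spread[of T] T by (intro mult_right_mono bnn) (auto simp: TT_def)
    also have "\<dots> = (real (card \<F>) * (\<sigma> / h) ^ t) * (h ^ card T * ?b T)"
      using h T by (simp add: TT_def power_divide)
    finally show "real (card {F\<in>\<F>. T \<subseteq> A F}) * ?b T \<le> (real (card \<F>) * (\<sigma> / h) ^ t) * (h ^ card T * ?b T)" .
  qed
  also have "\<dots> \<le> (\<Sum>T\<in>TT. (real (card \<F>) * (\<sigma> / h) ^ t) * bern_exp R (\<lambda>_. h) (\<lambda>Z. of_bool (good Z T)))"
  proof (intro sum_mono mult_left_mono)
    fix T assume T: "T \<in> TT"
    show "h ^ card T * ?b T \<le> bern_exp R (\<lambda>_. h) (\<lambda>Z. of_bool (good Z T))"
      by (rule bern_exp_plant) (use T h finR in \<open>auto simp: TT_def\<close>)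
  qed (use \<sigma> h in auto)
  also have "\<dots> = (real (card \<F>) * (\<sigma> / h) ^ t) * bern_exp R (\<lambda>_. h) (\<lambda>Z. \<Sum>T\<in>TT. of_bool (good Z T))"
    by (simp add: bern_exp_sum sum_distrib_left)
  also have "\<dots> \<le> (real (card \<F>) * (\<sigma> / h) ^ t) * bern_exp R (\<lambda>_. h) (\<lambda>Z. real (N choose t))"
  proof (intro mult_left_mono bern_exp_mono)
    fix Z
    show "(\<Sum>T\<in>TT. of_bool (good Z T)) \<le> real (N choose t)"
    proof (cases "{F \<in> \<F>. S F \<subseteq> Z} \<noteq> {} \<and> card (S (smallest Z)) \<le> N")
      case True
      then have f: "finite (S (smallest Z))" using smallest finS by blast
      have "(\<Sum>T\<in>TT. of_bool (good Z T)) = real (card {T\<in>TT. good Z T})"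
        using finTT by (simp add: Int_def)
      also have "card {T\<in>TT. good Z T} \<le> card {T. T \<subseteq> S (smallest Z) \<and> card T = t}"
        by (intro card_mono) (use f in \<open>auto simp: good_def\<close>)
      also have "\<dots> = card (S (smallest Z)) choose t" by (rule n_subsets[OF f])
      also have "\<dots> \<le> N choose t" using True by (intro binomial_right_mono) auto
      finally show ?thesis by simp
    next
      case False
      then have "\<not> good Z T" for T unfolding good_def by metis
      then show ?thesis by simp
    qed
  qed (use \<sigma> h in auto)
  also have "\<dots> = real (card \<F>) * (\<sigma> / h) ^ t * real (N choose t)"
    using finR by (simp add: bern_exp_const)
  finally show ?thesis .
qed

text \<open>With \<open>S F\<close> the part of \<open>F\<close> that earlier rounds left uncovered, this
says that after the round \<open>W\<close> no member of the family is within \<open>q - 1\<close> elements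
of being covered.\<close>

definition bad :: "nat \<Rightarrow> ('f \<Rightarrow> 'a set) \<Rightarrow> 'a set \<Rightarrow> bool" where
  "bad q S W \<longleftrightarrow> (\<forall>F\<in>\<F>. q \<le> card (S F - W))"

text \<open>A fragment is either smaller by a factor \<open>6\<close> than the set it comes from, or it has
size \<open>t\<close> and comes from a set of size at most \<open>6 t\<close>. The second case has
probability at most \<open>(64 \<sigma>/h)^t \<le> 36^(-t)\<close> by \<open>fragment_count\<close>,
which beats the \<open>q\<close>-th power \<open>t^q \<le> q^q e^t\<close>. On the bad event all sizes
are at least \<open>q\<close>, so \<open>q^q\<close> can be charged to the moment on the right; no additive
error remains, and the estimate can be iterated. Each case contributes at most \<open>6^(-q)\<close> times
the moment, and \<open>2 6^(-q) \<le> 3^(-q)\<close>.\<close>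

lemma fragment_step:
  assumes S: "\<And>F. F \<in> \<F> \<Longrightarrow> S F \<subseteq> A F" and q: "q \<ge> 1" and h\<sigma>: "2304 * \<sigma> \<le> h"
  shows "bern_exp R (\<lambda>_. h) (\<lambda>W. of_bool (bad q S W) * (\<Sum>F\<in>\<F>. real (card (fragment \<F> S W F)) ^ q))
    \<le> (1/3) ^ q * (\<Sum>F\<in>\<F>. real (card (S F)) ^ q)"
proof (cases "\<forall>F\<in>\<F>. q \<le> card (S F)")
  case False
  have finS: "finite (S F)" if "F \<in> \<F>" for F
    using S[OF that] A[OF that] finR by (meson finite_subset)
  have "\<not> bad q S W" for W
  proof
    assume "bad q S W"
    moreover have "card (S F - W) \<le> card (S F)" if "F \<in> \<F>" for F
      using finS[OF that] by (intro card_mono) auto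
    ultimately show False using False unfolding bad_def by fastforce
  qed
  then have "bern_exp R (\<lambda>_. h) (\<lambda>W. of_bool (bad q S W) * (\<Sum>F\<in>\<F>. real (card (fragment \<F> S W F)) ^ q)) = 0"
    using bern_exp_const[OF finR, of _ 0] by simp
  then show ?thesis by (simp add: sum_nonneg)
next
  case big: True
  have finS: "finite (S F)" if "F \<in> \<F>" for F
    using S[OF that] A[OF that] finR by (meson finite_subset)
  define M where "M = card R"
  define Y where "Y = (\<Sum>F\<in>\<F>. real (card (S F)) ^ q)"
  have Y: "real (card \<F>) * real q ^ q \<le> Y"
  proof -
    have "real (card \<F>) * real q ^ q = (\<Sum>F\<in>\<F>. real q ^ q)" by simp
    also have "\<dots> \<le> Y" unfolding Y_def by (intro sum_mono power_mono) (use big in auto)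
    finally show ?thesis .
  qed
  define ind where "ind W F t = (of_bool (card (fragment \<F> S W F) = t \<and> card (S F) \<le> 6 * t) :: real)" for W F t
  have ind0: "0 \<le> ind W F t" for W F t by (simp add: ind_def)
  have "bern_exp R (\<lambda>_. h) (\<lambda>W. of_bool (bad q S W) * (\<Sum>F\<in>\<F>. real (card (fragment \<F> S W F)) ^ q))
    \<le> bern_exp R (\<lambda>_. h) (\<lambda>W. (\<Sum>F\<in>\<F>. (1/6) ^ q * real (card (S F)) ^ q + (\<Sum>t=q..M. real t ^ q * ind W F t)))"
  proof (intro bern_exp_mono)
    fix W assume W: "W \<subseteq> R"
    show "of_bool (bad q S W) * (\<Sum>F\<in>\<F>. real (card (fragment \<F> S W F)) ^ q)
      \<le> (\<Sum>F\<in>\<F>. (1/6) ^ q * real (card (S F)) ^ q + (\<Sum>t=q..M. real t ^ q * ind W F t))"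
    proof (cases "bad q S W")
      case True
      have "real (card (fragment \<F> S W F)) ^ q \<le> (1/6) ^ q * real (card (S F)) ^ q + (\<Sum>t=q..M. real t ^ q * ind W F t)"
        if F: "F \<in> \<F>" for F
      proof (cases "card (S F) \<le> 6 * card (fragment \<F> S W F)")
        case small: True
        define t where "t = card (fragment \<F> S W F)"
        obtain F' where F': "F' \<in> \<F>" "fragment \<F> S W F = S F' - W" using fragment_obtain[OF F] by metis
        have "q \<le> card (S F' - W)" using True F'(1) unfolding bad_def by blast
        then have "q \<le> t" unfolding t_def F'(2) .
        moreover have "t \<le> M" unfolding t_def M_def
          by (rule card_mono[OF finR]) (use fragment_subset[OF F, where S=S and W=W] S[OF F] A[OF F] in blast)
        ultimately have a: "real t ^ q * ind W F t \<le> (\<Sum>t=q..M. real t ^ q * ind W F t)"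
          by (intro member_le_sum) (auto simp: ind0)
        have b: "0 \<le> (1/6::real) ^ q * real (card (S F)) ^ q" by simp
        have "ind W F t = 1" using small by (simp add: ind_def t_def)
        with a have "real t ^ q \<le> (\<Sum>t=q..M. real t ^ q * ind W F t)" by simp
        with b show ?thesis unfolding t_def by linarith
      next
        case False
        then have "real (card (fragment \<F> S W F)) \<le> (1/6) * real (card (S F))" by simp
        then have "real (card (fragment \<F> S W F)) ^ q \<le> ((1/6) * real (card (S F))) ^ q"
          by (intro power_mono) auto
        moreover have "0 \<le> (\<Sum>t=q..M. real t ^ q * ind W F t)" by (intro sum_nonneg) (simp add: ind0)
        ultimately show ?thesis unfolding power_mult_distrib by linarith
      qed
      then have "(\<Sum>F\<in>\<F>. real (card (fragment \<F> S W F)) ^ q) \<le> (\<Sum>F\<in>\<F>. (1/6) ^ q * real (card (S F)) ^ q + (\<Sum>t=q..M. real t ^ q * ind W F t))"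
        by (rule sum_mono)
      then show ?thesis using True by simp
    next
      case False
      then have "of_bool (bad q S W) = (0::real)" by (simp only: of_bool_eq)
      then show ?thesis by (simp only: mult_zero_left) (intro sum_nonneg add_nonneg_nonneg, simp_all add: ind0 sum_nonneg)
    qed
  qed (use h in auto)
  also have "\<dots> = (1/6) ^ q * Y + (\<Sum>t=q..M. real t ^ q * (\<Sum>F\<in>\<F>. bern_exp R (\<lambda>_. h) (\<lambda>W. ind W F t)))"
  proof -
    have "bern_exp R (\<lambda>_. h) (\<lambda>W. (\<Sum>F\<in>\<F>. (1/6) ^ q * real (card (S F)) ^ q + (\<Sum>t=q..M. real t ^ q * ind W F t)))
      = (\<Sum>F\<in>\<F>. (1/6) ^ q * real (card (S F)) ^ q + (\<Sum>t=q..M. real t ^ q * bern_exp R (\<lambda>_. h) (\<lambda>W. ind W F t)))"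
      by (simp only: bern_exp_sum bern_exp_add bern_exp_cmult bern_exp_const[OF finR])
    also have "\<dots> = (1/6) ^ q * Y + (\<Sum>F\<in>\<F>. \<Sum>t=q..M. real t ^ q * bern_exp R (\<lambda>_. h) (\<lambda>W. ind W F t))"
      unfolding Y_def by (simp only: sum.distrib sum_distrib_left)
    also have "(\<Sum>F\<in>\<F>. \<Sum>t=q..M. real t ^ q * bern_exp R (\<lambda>_. h) (\<lambda>W. ind W F t))
      = (\<Sum>t=q..M. \<Sum>F\<in>\<F>. real t ^ q * bern_exp R (\<lambda>_. h) (\<lambda>W. ind W F t))" by (rule sum.swap)
    finally show ?thesis by (simp only: sum_distrib_left)
  qed
  also have "(\<Sum>t=q..M. real t ^ q * (\<Sum>F\<in>\<F>. bern_exp R (\<lambda>_. h) (\<lambda>W. ind W F t)))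
     \<le> (\<Sum>t=q..M. (real (card \<F>) * real q ^ q) * (1/12) ^ t)"
  proof (rule sum_mono)
    fix t assume t: "t \<in> {q..M}"
    \<comment> \<open>\<open>(t/q)^q = (1 + (t - q)/q)^q \<le> exp (t - q)\<close>\<close>
    have "real t ^ q \<le> real q ^ q * exp (real t)"
    proof -
      have "(real t / real q) ^ q = (1 + (real t - real q) / real q) ^ q" using q by (simp add: diff_divide_distrib)
      also have "\<dots> \<le> exp ((real t - real q) / real q) ^ q"
        using t q by (intro power_mono exp_ge_add_one_self) auto
      also have "\<dots> = exp (real t - real q)" using q exp_of_nat_mult[of q "(real t - real q) / real q"] by simp
      also have "\<dots> \<le> exp (real t)" by simp
      finally have "(real t / real q) ^ q \<le> exp (real t)" .
      then show ?thesis using q by (simp add: power_divide field_simps)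
    qed
    also have "exp (real t) = exp 1 ^ t" using exp_of_nat_mult[of t "1::real"] by simp
    also have "exp 1 ^ t \<le> (3::real) ^ t" by (intro power_mono exp_le) auto
    finally have t1: "real t ^ q \<le> real q ^ q * 3 ^ t" by (simp add: mult_left_mono)
    \<comment> \<open>\<open>64 = 2^6\<close>; together with \<open>2304 \<sigma> \<le> h\<close> and \<open>2304 = 64 * 36\<close> this leaves \<open>36^(-t)\<close>\<close>
    have "real ((6 * t) choose t) \<le> 64 ^ t"
    proof -
      have "(6 * t) choose t \<le> 2 ^ (6 * t)" by (rule binomial_le_pow2)
      also have "(2::nat) ^ (6 * t) = 64 ^ t" by (simp add: power_mult)
      finally show ?thesis by (metis of_nat_le_iff of_nat_numeral of_nat_power)
    qed
    then have "(\<sigma> / h) ^ t * real ((6 * t) choose t) \<le> (\<sigma> / h) ^ t * 64 ^ t"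
      using \<sigma> h by (intro mult_left_mono) auto
    also have "\<dots> = (64 * \<sigma> / h) ^ t" by (simp add: power_mult_distrib power_divide)
    also have "\<dots> \<le> (1/36) ^ t"
      using \<sigma> h h\<sigma> by (intro power_mono) (auto simp: field_simps)
    finally have t2: "(\<sigma> / h) ^ t * real ((6 * t) choose t) \<le> (1/36) ^ t" .
    have "(\<Sum>F\<in>\<F>. bern_exp R (\<lambda>_. h) (\<lambda>W. ind W F t)) \<le> real (card \<F>) * (\<sigma> / h) ^ t * real ((6 * t) choose t)"
      unfolding ind_def by (rule fragment_count[OF S])
    also have "\<dots> \<le> real (card \<F>) * (1/36) ^ t"
      using t2 by (simp add: mult.assoc mult_left_mono)
    finally have "real t ^ q * (\<Sum>F\<in>\<F>. bern_exp R (\<lambda>_. h) (\<lambda>W. ind W F t)) \<le> (real q ^ q * 3 ^ t) * (real (card \<F>) * (1/36) ^ t)"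
      using t1 by (intro mult_mono) (auto intro!: sum_nonneg bern_exp_nonneg simp: less_imp_le[OF h(1)] h(2) ind0)
    also have "\<dots> = (real (card \<F>) * real q ^ q) * ((3 * (1/36)) ^ t)"
      unfolding power_mult_distrib by (simp add: algebra_simps)
    finally show "real t ^ q * (\<Sum>F\<in>\<F>. bern_exp R (\<lambda>_. h) (\<lambda>W. ind W F t)) \<le> (real (card \<F>) * real q ^ q) * (1/12) ^ t"
      by simp
  qed
  also have "\<dots> \<le> Y * (1/6) ^ q"
  proof -
    have "(\<Sum>t=q..M. (1/12::real) ^ t) \<le> 2 * (1/12) ^ q"
      by (rule geometric_tail) auto
    also have "\<dots> \<le> 2 ^ q * (1/12) ^ q"
      using q power_increasing[of 1 q "2::real"] by (intro mult_right_mono) auto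
    also have "\<dots> = (1/6) ^ q" using power_mult_distrib[of 2 "1/12::real" q] by simp
    finally have "(\<Sum>t=q..M. (1/12::real) ^ t) \<le> (1/6) ^ q" .
    then show ?thesis
      unfolding sum_distrib_left[symmetric] using Y by (intro mult_mono) (auto intro!: sum_nonneg simp: Y_def)
  qed
  also have "(1/6) ^ q * Y + Y * (1/6) ^ q = (2 * (1/6) ^ q) * Y" by simp
  also have "\<dots> \<le> (2 ^ q * (1/6) ^ q) * Y"
    using q power_increasing[of 1 q "2::real"] by (intro mult_right_mono) (auto intro!: sum_nonneg simp: Y_def)
  also have "2 ^ q * (1/6::real) ^ q = (1/3) ^ q" using power_mult_distrib[of 2 "1/6::real" q] by simp
  finally show ?thesis by (simp add: Y_def)
qed

text \<open>A bad outcome of \<open>k + 1\<close> rounds is bad in the first round and, for the fragments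
left by it, in the other \<open>k\<close>. So the moments in \<open>fragment_step\<close> multiply, and
Markov's inequality with \<open>q^q\<close> ends the argument.\<close>

lemma bad_after_rounds:
  assumes "\<And>F. F \<in> \<F> \<Longrightarrow> S F \<subseteq> A F" and q: "q \<ge> 1" and h\<sigma>: "2304 * \<sigma> \<le> h"
  shows "(real (card \<F>) * real q ^ q) * bern_exp R (\<lambda>_. 1 - (1 - h) ^ k) (\<lambda>W. of_bool (bad q S W))
    \<le> ((1/3) ^ q) ^ k * (\<Sum>F\<in>\<F>. real (card (S F)) ^ q)"
  using assms(1)
proof (induction k arbitrary: S)
  case 0
  have z: "bern_exp R (\<lambda>_. 0) f = f {}" for f
    using finR
  proof (induction R arbitrary: f rule: finite_induct)
    case (insert j I) then show ?case by (simp add: bern_exp_insert)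
  qed simp
  show ?case
  proof (cases "bad q S {}")
    case True
    have "(real (card \<F>) * real q ^ q) = (\<Sum>F\<in>\<F>. real q ^ q)" by simp
    also have "\<dots> \<le> (\<Sum>F\<in>\<F>. real (card (S F)) ^ q)"
      using True by (intro sum_mono power_mono) (auto simp: bad_def)
    finally show ?thesis using True by (simp add: z)
  qed (simp add: z sum_nonneg)
next
  case (Suc k)
  let ?c = "real (card \<F>) * real q ^ q"
  let ?b = "\<lambda>_. 1 - (1 - h) ^ k"
  have "bern_exp R (\<lambda>_. 1 - (1 - h) ^ Suc k) (\<lambda>W. of_bool (bad q S W))
    = bern_exp R (\<lambda>_. h) (\<lambda>X. bern_exp R ?b (\<lambda>Y. of_bool (bad q S (X \<union> Y))))"
    using bern_exp_union[OF finR, of "\<lambda>_. h" ?b "\<lambda>W. of_bool (bad q S W)"]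
    by (simp add: algebra_simps)
  also have "?c * \<dots> = bern_exp R (\<lambda>_. h) (\<lambda>X. ?c * bern_exp R ?b (\<lambda>Y. of_bool (bad q S (X \<union> Y))))"
    by (simp add: bern_exp_cmult)
  also have "\<dots> \<le> bern_exp R (\<lambda>_. h) (\<lambda>X. ((1/3) ^ q) ^ k * (of_bool (bad q S X) * (\<Sum>F\<in>\<F>. real (card (fragment \<F> S X F)) ^ q)))"
  proof (intro bern_exp_mono)
    fix X assume X: "X \<subseteq> R"
    have b01: "0 \<le> ?b i \<and> ?b i \<le> 1" for i :: 'a using h by (auto intro: power_le_one)
    have fS: "F \<in> \<F> \<Longrightarrow> finite (S F)" for F
      using Suc.prems A finR by (meson finite_subset)
    show "?c * bern_exp R ?b (\<lambda>Y. of_bool (bad q S (X \<union> Y))) \<le> ((1/3) ^ q) ^ k * (of_bool (bad q S X) * (\<Sum>F\<in>\<F>. real (card (fragment \<F> S X F)) ^ q))"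
    proof (cases "bad q S X")
      case True
      have "bern_exp R ?b (\<lambda>Y. of_bool (bad q S (X \<union> Y))) \<le> bern_exp R ?b (\<lambda>Y. of_bool (bad q (fragment \<F> S X) Y))"
      proof (intro bern_exp_mono b01)
        fix Y
        have "bad q (fragment \<F> S X) Y" if "bad q S (X \<union> Y)"
          unfolding bad_def
        proof
          fix F assume F: "F \<in> \<F>"
          obtain F' where F': "F' \<in> \<F>" "fragment \<F> S X F = S F' - X" using fragment_obtain[OF F] by metis
          have "fragment \<F> S X F - Y = S F' - (X \<union> Y)" unfolding F'(2) by blast
          then show "q \<le> card (fragment \<F> S X F - Y)" using that F'(1) unfolding bad_def by metis
        qed
        then show "of_bool (bad q S (X \<union> Y)) \<le> (of_bool (bad q (fragment \<F> S X) Y) :: real)" by auto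
      qed
      then have "?c * bern_exp R ?b (\<lambda>Y. of_bool (bad q S (X \<union> Y))) \<le> ?c * bern_exp R ?b (\<lambda>Y. of_bool (bad q (fragment \<F> S X) Y))"
        by (intro mult_left_mono) auto
      also have "\<dots> \<le> ((1/3) ^ q) ^ k * (\<Sum>F\<in>\<F>. real (card (fragment \<F> S X F)) ^ q)"
        by (rule Suc.IH, rule subset_trans[OF fragment_subset Suc.prems])
      finally show ?thesis using True by simp
    next
      case False
      have "\<not> bad q S (X \<union> Y)" for Y
      proof
        assume b: "bad q S (X \<union> Y)"
        have "card (S F - (X \<union> Y)) \<le> card (S F - X)" if "F \<in> \<F>" for F
          using fS[OF that] by (intro card_mono) auto
        then show False using b False unfolding bad_def by (meson le_trans)
      qed
      then show ?thesis using False by (simp add: bern_exp_const[OF finR])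
    qed
  qed (use h in auto)
  also have "\<dots> = ((1/3) ^ q) ^ k * bern_exp R (\<lambda>_. h) (\<lambda>X. of_bool (bad q S X) * (\<Sum>F\<in>\<F>. real (card (fragment \<F> S X F)) ^ q))"
    by (rule bern_exp_cmult)
  also have "\<dots> \<le> ((1/3) ^ q) ^ k * ((1/3) ^ q * (\<Sum>F\<in>\<F>. real (card (S F)) ^ q))"
    by (intro mult_left_mono fragment_step[OF Suc.prems q h\<sigma>]) auto
  finally show ?case by (simp add: mult.assoc mult.left_commute)
qed

end

section \<open>The uniform matching is spread\<close>

definition matchings :: "'a set \<Rightarrow> nat \<Rightarrow> nat \<Rightarrow> 'a set set set" where
  "matchings U r j = {M. M \<subseteq> nsets U r \<and> disjoint M \<and> card M = j}"

lemma finite_matchings: "finite U \<Longrightarrow> finite (matchings U r j)"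
  unfolding matchings_def
  by (rule finite_subset[of _ "Pow (nsets U r)"]) (auto intro: finite_imp_finite_nsets)

lemma card_nsets: "finite U \<Longrightarrow> card (nsets U r) = card U choose r"
proof -
  assume U: "finite U"
  then have "nsets U r = {B. B \<subseteq> U \<and> card B = r}"
    by (auto simp: nsets_def intro: finite_subset)
  then show ?thesis using n_subsets[OF U] by simp
qed

lemma card_Union_matching:
  assumes "finite U" "M \<in> matchings U r j"
  shows "card (\<Union>M) = r * j" "\<Union>M \<subseteq> U" "finite M"
proof -
  have M: "M \<subseteq> nsets U r" "disjoint M" "card M = j" using assms by (auto simp: matchings_def)
  show fin: "finite M" using M assms by (meson finite_imp_finite_nsets finite_subset)
  show "\<Union>M \<subseteq> U" using M by (auto simp: nsets_def)
  have "card (\<Union>M) = sum card M"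
    by (rule card_Union_disjoint) (use M in \<open>auto simp: nsets_def\<close>)
  also have "\<dots> = (\<Sum>K\<in>M. r)" by (intro sum.cong) (use M in \<open>auto simp: nsets_def\<close>)
  finally show "card (\<Union>M) = r * j" using M by simp
qed

lemma card_matchings_containing:
  assumes U: "finite U" and r: "r > 0" and T: "T \<in> matchings U r t"
  shows "card {M \<in> matchings U r (t + j). T \<subseteq> M} = card (matchings (U - \<Union>T) r j)"
proof (rule bij_betw_same_card)
  have finT: "finite T" and cT: "card T = t" and dT: "disjoint T" and sT: "T \<subseteq> nsets U r"
    using card_Union_matching[OF U T] T by (auto simp: matchings_def)
  show "bij_betw (\<lambda>M. M - T) {M \<in> matchings U r (t + j). T \<subseteq> M} (matchings (U - \<Union>T) r j)"
  proof (rule bij_betw_byWitness[where f' = "\<lambda>M. M \<union> T"])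
    have d: "N \<inter> T = {}" if "N \<in> matchings (U - \<Union>T) r j" for N
    proof -
      have "K \<notin> T" if "K \<in> N" for K
      proof
        assume "K \<in> T"
        moreover have "K \<subseteq> U - \<Union>T" "card K = r" using that \<open>N \<in> _\<close> by (auto simp: matchings_def nsets_def)
        ultimately have "K = {}" by auto
        then show False using \<open>card K = r\<close> r by auto
      qed
      then show ?thesis by auto
    qed
    show "\<forall>a\<in>{M \<in> matchings U r (t + j). T \<subseteq> M}. a - T \<union> T = a" by auto
    show "\<forall>a'\<in>matchings (U - \<Union>T) r j. a' \<union> T - T = a'" using d by blast
    show "(\<lambda>M. M - T) ` {M \<in> matchings U r (t + j). T \<subseteq> M} \<subseteq> matchings (U - \<Union>T) r j"
    proof safe
      fix M assume M: "M \<in> matchings U r (t + j)" "T \<subseteq> M"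
      have "K \<in> nsets (U - \<Union>T) r" if "K \<in> M - T" for K
      proof -
        have "K \<in> nsets U r" using that M by (auto simp: matchings_def)
        moreover have "K \<inter> L = {}" if "L \<in> T" for L
          using disjointD[of M K L] M that \<open>K \<in> M - T\<close> by (auto simp: matchings_def)
        ultimately show ?thesis by (auto simp: nsets_def)
      qed
      moreover have "disjoint (M - T)" using M by (auto simp: matchings_def intro: pairwise_subset)
      moreover have "card (M - T) = j" using M cT finT by (simp add: card_Diff_subset matchings_def)
      ultimately show "M - T \<in> matchings (U - \<Union>T) r j" by (auto simp: matchings_def)
    qed
    show "(\<lambda>M. M \<union> T) ` matchings (U - \<Union>T) r j \<subseteq> {M \<in> matchings U r (t + j). T \<subseteq> M}"
    proof safe
      fix N assume N: "N \<in> matchings (U - \<Union>T) r j"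
      have fN: "finite N" using card_Union_matching[of "U - \<Union>T"] U N by blast
      have N': "N \<subseteq> nsets (U - \<Union>T) r" "disjoint N" "card N = j" using N by (auto simp: matchings_def)
      have "card (N \<union> T) = t + j" using d[OF N] fN finT cT N' by (simp add: card_Un_disjoint)
      moreover have "N \<union> T \<subseteq> nsets U r" using N' sT by (auto simp: nsets_def)
      moreover have "disjoint (N \<union> T)"
      proof (rule disjointI)
        fix a b assume ab: "a \<in> N \<union> T" "b \<in> N \<union> T" "a \<noteq> b"
        have "x \<inter> y = {}" if "x \<in> N" "y \<in> T" for x y
          using N' that by (auto simp: nsets_def)
        then show "a \<inter> b = {}"
          using ab disjointD[OF N'(2), of a b] disjointD[OF dT, of a b] by (elim UnE) (auto simp: Int_commute)
      qed
      ultimately show "N \<union> T \<in> matchings U r (t + j)" by (auto simp: matchings_def)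
    qed
  qed
qed

text \<open>Counting pairs of a matching and one of its members gives the recursion behind the closed
formula.\<close>

lemma card_matchings:
  assumes "finite U" "r > 0" "r * j \<le> card U"
  shows "card (matchings U r j) * (fact j * fact r ^ j * fact (card U - r * j)) = (fact (card U) :: nat)"
  using assms(1,3)
proof (induction j arbitrary: U)
  case 0
  have "matchings U r 0 = {{}}"
    using 0 by (auto simp: matchings_def dest!: finite_subset[OF _ finite_imp_finite_nsets])
  then show ?case by simp
next
  case (Suc j)
  let ?u = "card U"
  let ?\<M> = "matchings U r (Suc j)"
  have fM: "finite ?\<M>" using Suc finite_matchings by blast
  have fN: "finite (nsets U r)" using Suc finite_imp_finite_nsets by blast
  have ru: "r \<le> ?u" using Suc.prems by simp
  have one: "card {M \<in> ?\<M>. K \<in> M} * (fact j * fact r ^ j * fact (?u - r * Suc j)) = (fact (?u - r) :: nat)"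
    if K: "K \<in> nsets U r" for K
  proof -
    have "{K} \<in> matchings U r 1" using K by (auto simp: matchings_def)
    from card_matchings_containing[OF Suc.prems(1) assms(2) this, of j]
    have "card {M \<in> ?\<M>. K \<in> M} = card (matchings (U - K) r j)" by simp
    moreover have cK: "card (U - K) = ?u - r" using K Suc.prems by (auto simp: nsets_def card_Diff_subset)
    moreover have "card (matchings (U - K) r j) * (fact j * fact r ^ j * fact (card (U - K) - r * j)) = fact (card (U - K))"
      by (rule Suc.IH) (use Suc.prems cK in auto)
    ultimately show ?thesis by simp
  qed
  have "card ?\<M> * Suc j = (\<Sum>M\<in>?\<M>. card M)" by (simp add: matchings_def)
  also have "\<dots> = (\<Sum>M\<in>?\<M>. \<Sum>K\<in>nsets U r. of_bool (K \<in> M))"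
  proof (rule sum.cong)
    fix M assume "M \<in> ?\<M>"
    then have "nsets U r \<inter> {K. K \<in> M} = M" by (auto simp: matchings_def)
    then show "card M = (\<Sum>K\<in>nsets U r. of_bool (K \<in> M))" using fN by simp
  qed simp
  also have "\<dots> = (\<Sum>K\<in>nsets U r. \<Sum>M\<in>?\<M>. of_bool (K \<in> M))" by (rule sum.swap)
  also have "\<dots> = (\<Sum>K\<in>nsets U r. card {M \<in> ?\<M>. K \<in> M})"
    using fM by (simp add: Int_def)
  finally have "card ?\<M> * Suc j * (fact j * fact r ^ j * fact (?u - r * Suc j))
     = (\<Sum>K\<in>nsets U r. card {M \<in> ?\<M>. K \<in> M} * (fact j * fact r ^ j * fact (?u - r * Suc j)))"
    by (simp add: sum_distrib_right)
  also have "\<dots> = (?u choose r) * fact (?u - r)"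
    using one Suc.prems(1) by (simp add: card_nsets)
  finally have "card ?\<M> * (fact (Suc j) * fact r ^ j * fact (?u - r * Suc j)) * fact r = (?u choose r) * fact (?u - r) * fact r"
    by (simp add: algebra_simps)
  also have "\<dots> = fact ?u" using binomial_fact_lemma[OF ru] by (simp add: algebra_simps)
  finally show ?case by (simp add: algebra_simps)
qed

text \<open>In the induction, passing from \<open>(m + 1)^k\<close> to \<open>m^k\<close> costs a factor
\<open>(1 + 1/m)^k \<le> e \<le> 3\<close>, as \<open>k \<le> m\<close>.\<close>

lemma falling_power_lower:
  assumes "k \<le> n"
  shows "real n ^ k * fact (n - k) \<le> 3 ^ k * fact n"
  using assms
proof (induction k arbitrary: n)
  case (Suc k)
  then obtain m where n: "n = Suc m" by (cases n) auto
  have km: "k \<le> m" using Suc n by simp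
  have "real (Suc m) ^ k \<le> 3 * real m ^ k"
  proof (cases "m = 0")
    case False
    have eq: "real (Suc m) ^ k = real m ^ k * (1 + 1 / real m) ^ k"
      using False by (simp flip: power_mult_distrib add: field_simps)
    have "(1 + 1 / real m) ^ k \<le> (1 + 1 / real m) ^ m"
      using km by (intro power_increasing) auto
    also have "(1 + 1 / real m) ^ m \<le> exp (1 / real m) ^ m"
      by (intro power_mono exp_ge_add_one_self) auto
    also have "\<dots> = exp 1" using False exp_of_nat_mult[of m "1 / real m"] by simp
    also have "\<dots> \<le> 3" by (rule exp_le)
    finally show ?thesis unfolding eq using mult_left_mono[of "(1 + 1 / real m) ^ k" 3 "real m ^ k"]
      by (simp add: mult.commute)
  qed (use km in auto)
  then have "real n ^ Suc k * fact (n - Suc k) \<le> real n * (3 * real m ^ k) * fact (m - k)"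
    by (simp add: n mult_right_mono mult_left_mono)
  also have "\<dots> = 3 * real n * (real m ^ k * fact (m - k))" by simp
  also have "\<dots> \<le> 3 * real n * (3 ^ k * fact m)"
    by (intro mult_left_mono Suc.IH km) auto
  also have "\<dots> = 3 ^ Suc k * fact n" by (simp add: n)
  finally show ?case .
qed simp

text \<open>The matchings that contain a matching \<open>T\<close> correspond to the matchings of the
uncovered vertices, so both numbers are known from \<open>card_matchings\<close>. The estimate has to hold
for all sizes of \<open>T\<close> up to \<open>l\<close>. Near the end few vertices remain and the
individual factors of the quotient are large, but their product is not.\<close>

lemma matchings_spread:
  fixes V :: "'a set"
  assumes V: "finite V" "card V > 0" and r: "r > 0" and l: "r * l \<le> card V" and T: "T \<subseteq> nsets V r"
  shows "real (card {F \<in> matchings V r l. T \<subseteq> F})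
    \<le> (fact r * 3 ^ r / real (card V) ^ (r - 1)) ^ card T * real (card (matchings V r l))"
proof (cases "\<exists>F \<in> matchings V r l. T \<subseteq> F")
  case False
  then have "{F \<in> matchings V r l. T \<subseteq> F} = {}" by auto
  then show ?thesis by (simp only:) simp
next
  case True
  let ?n = "card V"
  define t where "t = card T"
  obtain F where F: "F \<in> matchings V r l" "T \<subseteq> F" using True by auto
  have finF: "finite F" using card_Union_matching[OF V(1) F(1)] by auto
  have tl: "t \<le> l" using F finF unfolding t_def matchings_def by (auto intro: card_mono)
  have TM: "T \<in> matchings V r t" using F T unfolding matchings_def t_def by (auto intro: pairwise_subset)
  define j where "j = l - t"
  have l': "l = t + j" using tl j_def by simp
  have rt: "r * t + r * j \<le> ?n" using l l' by (simp add: algebra_simps)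
  define a where "a = card {F \<in> matchings V r l. T \<subseteq> F}"
  define b where "b = card (matchings V r l)"
  have a1: "a = card (matchings (V - \<Union>T) r j)"
    unfolding a_def l' by (rule card_matchings_containing[OF V(1) r TM])
  have cVT: "card (V - \<Union>T) = ?n - r * t"
    using card_Union_matching[OF V(1) TM] V(1) by (simp add: card_Diff_subset finite_subset)
  have "card (matchings (V - \<Union>T) r j) * (fact j * fact r ^ j * fact (card (V - \<Union>T) - r * j)) = (fact (card (V - \<Union>T)) :: nat)"
    by (rule card_matchings) (use V r rt cVT in auto)
  then have A: "a * (fact j * fact r ^ j * fact (?n - r * t - r * j)) = (fact (?n - r * t) :: nat)"
    unfolding a1[symmetric] cVT .
  have "b * (fact l * fact r ^ l * fact (?n - r * l)) = (fact ?n :: nat)"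
    unfolding b_def by (rule card_matchings) (use V r l in auto)
  then have B: "b * (fact l * fact r ^ l * fact (?n - r * t - r * j)) = (fact ?n :: nat)"
    by (simp add: l' algebra_simps)
  define c where "c = (fact j * fact r ^ j * fact (?n - r * t - r * j) :: real)"
  have c: "c > 0" unfolding c_def by simp
  have A': "real a * c = fact (?n - r * t)"
    using arg_cong[OF A, of real] by (simp add: c_def)
  have flj: "fact l \<le> real ?n ^ t * fact j"
  proof -
    have "fact l \<le> real l ^ t * fact j"
    proof -
      have "(fact (t + j) :: nat) \<le> (t + j) ^ t * fact j"
      proof (induction t)
        case (Suc t)
        have "fact (Suc t + j) = (Suc t + j) * (fact (t + j) :: nat)" by simp
        also have "\<dots> \<le> (Suc t + j) * ((t + j) ^ t * fact j)" by (rule mult_le_mono2[OF Suc])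
        also have "\<dots> \<le> (Suc t + j) * ((Suc t + j) ^ t * fact j)"
          by (intro mult_left_mono mult_right_mono power_mono) auto
        finally show ?case by (simp add: algebra_simps)
      qed simp
      then have "real (fact (t + j)) \<le> real ((t + j) ^ t * fact j)" by (rule of_nat_mono)
      then show ?thesis by (simp add: l')
    qed
    also have "l \<le> ?n" using l r by (metis le_trans mult_le_mono1 nat_mult_1 Suc_leI One_nat_def)
    then have "real l ^ t * fact j \<le> real ?n ^ t * fact j"
      by (intro mult_right_mono power_mono) auto
    finally show ?thesis .
  qed
  have "fact ?n = real b * (fact l * fact r ^ t) * (c / fact j)"
    using arg_cong[OF B, of real] by (simp add: c_def l' power_add)
  also have "\<dots> \<le> real b * ((real ?n ^ t * fact j) * fact r ^ t) * (c / fact j)"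
    using flj c by (intro mult_right_mono mult_left_mono) auto
  also have "\<dots> = real b * c * (real ?n ^ t * fact r ^ t)" by simp
  finally have B': "fact ?n \<le> real b * c * (real ?n ^ t * fact r ^ t)" .
  have "real ?n ^ (r * t) * (real a * c) \<le> 3 ^ (r * t) * fact ?n"
    unfolding A' by (rule falling_power_lower) (use rt in simp)
  also have "\<dots> \<le> 3 ^ (r * t) * (real b * c * (real ?n ^ t * fact r ^ t))"
    using B' by (intro mult_left_mono) auto
  finally have "real ?n ^ (r * t) * real a * c \<le> (3 ^ (r * t) * real b * (real ?n ^ t * fact r ^ t)) * c"
    by (simp add: algebra_simps)
  then have 1: "real ?n ^ (r * t) * real a \<le> 3 ^ (r * t) * real b * (real ?n ^ t * fact r ^ t)"
    using c by simp
  have "r * t = (r - 1) * t + t" using r by (cases r) auto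
  then have "real ?n ^ (r * t) = real ?n ^ ((r - 1) * t) * real ?n ^ t" by (simp add: power_add)
  with 1 have "real ?n ^ t * (real ?n ^ ((r - 1) * t) * real a) \<le> real ?n ^ t * (3 ^ (r * t) * fact r ^ t * real b)"
    by (simp add: algebra_simps)
  then have 2: "real ?n ^ ((r - 1) * t) * real a \<le> 3 ^ (r * t) * fact r ^ t * real b"
    using V by simp
  have "real a \<le> (3 ^ (r * t) * fact r ^ t * real b) / real ?n ^ ((r - 1) * t)"
    using 2 V by (simp add: pos_le_divide_eq mult.commute)
  also have "\<dots> = (fact r * 3 ^ r / real ?n ^ (r - 1)) ^ t * real b"
    by (simp add: power_divide power_mult_distrib power_mult[symmetric])
  finally show ?thesis unfolding a_def b_def t_def .
qed

lemma matchings_nonempty: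
  assumes "finite V" "r > 0" "r * l \<le> card V"
  shows "matchings V r l \<noteq> {}"
  using card_matchings[OF assms] by (metis card.empty fact_nonzero mult_0)

section \<open>Edges between the blocks of a matching\<close>

text \<open>The blocks are the members of \<open>M\<close> and the singletons of the remaining vertices. For
a disjoint family they are the classes of an equivalence relation, and \<open>crossing M K\<close>
consists of the pairs in \<open>K\<close> that join two classes.\<close>

definition block :: "'a set set \<Rightarrow> 'a \<Rightarrow> 'a set" where
  "block M v = insert v (\<Union>{A \<in> M. v \<in> A})"

definition crossing :: "'a set set \<Rightarrow> 'a set \<Rightarrow> 'a set set" where
  "crossing M K = {e \<in> nsets K 2. \<not> (\<exists>A\<in>M. e \<subseteq> A)}"

lemma block_in: "disjoint M \<Longrightarrow> A \<in> M \<Longrightarrow> v \<in> A \<Longrightarrow> block M v = A"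
  unfolding block_def disjoint_def by blast

lemma block_eq_iff:
  assumes "disjoint M" "u \<noteq> v"
  shows "block M u = block M v \<longleftrightarrow> (\<exists>A\<in>M. {u, v} \<subseteq> A)"
proof
  assume eq: "block M u = block M v"
  have "u \<in> block M v" using eq by (auto simp: block_def)
  then show "\<exists>A\<in>M. {u, v} \<subseteq> A" using assms(2) by (auto simp: block_def)
next
  assume "\<exists>A\<in>M. {u, v} \<subseteq> A"
  then show "block M u = block M v" using block_in[OF assms(1)] by auto
qed

lemma card_block: "disjoint M \<Longrightarrow> (\<And>A. A \<in> M \<Longrightarrow> card A = r) \<Longrightarrow> r > 0 \<Longrightarrow> card (block M v) \<le> r \<and> finite (block M v)"
proof (cases "\<exists>A\<in>M. v \<in> A")
  case True
  assume a: "disjoint M" "\<And>A. A \<in> M \<Longrightarrow> card A = r" "r > 0"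
  obtain A where A: "A \<in> M" "v \<in> A" using True by auto
  then have "block M v = A" using block_in a by metis
  moreover have "finite A" using a A by (metis card_gt_0_iff)
  ultimately show ?thesis using a A by simp
next
  case False
  assume "r > 0"
  moreover have "block M v = {v}" using False by (auto simp: block_def)
  ultimately show ?thesis by simp
qed

lemma card_crossing_pairs:
  assumes "disjoint M" "finite K"
  shows "2 * card (crossing M K) = card {(u, v). u \<in> K \<and> v \<in> K \<and> block M u \<noteq> block M v}"
proof -
  let ?P = "{(u, v). u \<in> K \<and> v \<in> K \<and> block M u \<noteq> block M v}"
  have finP: "finite ?P" by (rule finite_subset[of _ "K \<times> K"]) (use assms in auto)
  have finC: "finite (crossing M K)"
    unfolding crossing_def using finite_imp_finite_nsets[OF assms(2)] by auto
  let ?f = "\<lambda>(u, v). {u, v}"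
  have "card ?P = (\<Sum>e\<in>crossing M K. card {z \<in> ?P. ?f z = e})"
  proof -
    have "?f ` ?P \<subseteq> crossing M K"
    proof
      fix e assume "e \<in> ?f ` ?P"
      then obtain u v where e: "e = {u, v}" and uv: "u \<in> K" "v \<in> K" "block M u \<noteq> block M v" by auto
      then have "u \<noteq> v" by auto
      then show "e \<in> crossing M K" unfolding e
        using block_eq_iff[OF assms(1), of u v] uv by (auto simp: crossing_def)
    qed
    then have "?P = (\<Union>e\<in>crossing M K. {z \<in> ?P. ?f z = e})" by blast
    then have "card ?P = card (\<Union>e\<in>crossing M K. {z \<in> ?P. ?f z = e})" by (rule arg_cong[where f=card])
    also have "\<dots> = (\<Sum>e\<in>crossing M K. card {z \<in> ?P. ?f z = e})"
      by (intro card_UN_disjoint finC) (use finP in auto)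
    finally show ?thesis .
  qed
  also have "\<dots> = (\<Sum>e\<in>crossing M K. 2)"
  proof (rule sum.cong)
    fix e assume e: "e \<in> crossing M K"
    then obtain u v where uv: "e = {u, v}" "u \<noteq> v" "u \<in> K" "v \<in> K"
      by (auto simp: crossing_def elim!: nsets2_E)
    then have "block M u \<noteq> block M v" using block_eq_iff[OF assms(1), of u v] e by (auto simp: crossing_def)
    then have "{z \<in> ?P. ?f z = e} = {(u, v), (v, u)}" using uv by (auto simp: doubleton_eq_iff)
    then show "card {z \<in> ?P. ?f z = e} = 2" using uv by simp
  qed simp
  finally show ?thesis by simp
qed

text \<open>If \<open>K\<close> meets \<open>c\<close> blocks in \<open>s\<^sub>1, ..., s\<^sub>c\<close>
vertices, twice the number of crossing pairs is the sum of \<open>s\<^sub>i (r - s\<^sub>i)\<close>. This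
is least when all but one \<open>s\<^sub>i\<close> equal \<open>1\<close>, with value
\<open>(c - 1) (2 r - c)\<close>.\<close>

lemma crossing_lower:
  assumes M: "disjoint M" and K: "finite K" "card K = r"
    and c: "c = card (block M ` K)" "2 \<le> c" "c + 1 \<le> r"
  shows "(c - 1) * (r + 1) \<le> 2 * card (crossing M K)"
proof -
  let ?C = "block M ` K"
  define s where "s A = card {v \<in> K. block M v = A}" for A
  have finC: "finite ?C" using K by simp
  have sum_s: "(\<Sum>A\<in>?C. s A) = r"
  proof -
    have "card K = (\<Sum>v\<in>K. 1)" by simp
    also have "\<dots> = (\<Sum>A\<in>?C. \<Sum>v\<in>{v. v \<in> K \<and> block M v = A}. 1)" by (rule sum.image_gen[OF K(1)])
    finally show ?thesis using K by (simp add: s_def)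
  qed
  have s1: "1 \<le> s A" if "A \<in> ?C" for A
  proof -
    have "{v \<in> K. block M v = A} \<noteq> {}" using that by auto
    then show ?thesis unfolding s_def using K by (simp add: Suc_le_eq card_gt_0_iff)
  qed
  have s2: "s A + c \<le> r + 1" if A: "A \<in> ?C" for A
  proof -
    have "card (?C - {A}) = (\<Sum>B\<in>?C - {A}. 1)" by simp
    also have "\<dots> \<le> (\<Sum>B\<in>?C - {A}. s B)" by (intro sum_mono s1) auto
    also have "\<dots> + s A = r" using sum.remove[OF finC A, of s] sum_s by simp
    finally have "card (?C - {A}) + s A \<le> r" by simp
    then show ?thesis using A finC c by simp
  qed
  have "2 * card (crossing M K) = card {(u, v). u \<in> K \<and> v \<in> K \<and> block M u \<noteq> block M v}"
    by (rule card_crossing_pairs[OF M K(1)])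
  also have "{(u, v). u \<in> K \<and> v \<in> K \<and> block M u \<noteq> block M v} = (SIGMA u:K. {v \<in> K. block M u \<noteq> block M v})" by auto
  also have "card \<dots> = (\<Sum>u\<in>K. card {v \<in> K. block M u \<noteq> block M v})" using K by (intro card_SigmaI) auto
  also have "\<dots> = (\<Sum>A\<in>?C. \<Sum>u\<in>{u. u \<in> K \<and> block M u = A}. card {v \<in> K. block M u \<noteq> block M v})"
    by (rule sum.image_gen[OF K(1)])
  also have "\<dots> = (\<Sum>A\<in>?C. s A * (r - s A))"
  proof (rule sum.cong)
    fix A assume A: "A \<in> ?C"
    have "{v \<in> K. A \<noteq> block M v} = K - {v \<in> K. block M v = A}" by auto
    then have "card {v \<in> K. A \<noteq> block M v} = r - s A" using K by (simp add: card_Diff_subset s_def)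
    then show "(\<Sum>u\<in>{u. u \<in> K \<and> block M u = A}. card {v \<in> K. block M u \<noteq> block M v}) = s A * (r - s A)"
      by (simp add: s_def)
  qed simp
  finally have eq: "2 * card (crossing M K) = (\<Sum>A\<in>?C. s A * (r - s A))" .
  have "int ((c - 1) * (r + 1)) \<le> (int c - 1) * (2 * int r - int c)"
  proof -
    have "int (c - 1) = int c - 1" using c(2) by linarith
    then have "int ((c - 1) * (r + 1)) = (int c - 1) * (int r + 1)" unfolding of_nat_mult by simp
    also have "\<dots> \<le> (int c - 1) * (2 * int r - int c)" using c by (intro mult_left_mono) auto
    finally show ?thesis .
  qed
  also have "\<dots> = (\<Sum>A\<in>?C. (int r - 1) + (int (s A) - 1) * (int c - 2))"
  proof -
    have "(\<Sum>A\<in>?C. (int r - 1) + (int (s A) - 1) * (int c - 2))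
      = int c * (int r - 1) + (int (\<Sum>A\<in>?C. s A) - int c) * (int c - 2)"
      by (simp add: sum.distrib sum_subtractf c(1) flip: sum_distrib_right)
    then show ?thesis using sum_s by (simp add: algebra_simps)
  qed
  also have "\<dots> \<le> (\<Sum>A\<in>?C. int (s A * (r - s A)))"
  proof (rule sum_mono)
    fix A assume A: "A \<in> ?C"
    \<comment> \<open>the concave function \<open>s (r - s)\<close> lies above its chord between \<open>s = 1\<close> and \<open>s = r - c + 1\<close>\<close>
    have "(int (s A) - 1) * (int c - 2) \<le> (int (s A) - 1) * (int r - 1 - int (s A))"
      using s1[OF A] s2[OF A] by (intro mult_left_mono) auto
    moreover have "int (s A * (r - s A)) = int (s A) * (int r - int (s A))"
      using s2[OF A] c by (simp add: of_nat_diff)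
    ultimately show "(int r - 1) + (int (s A) - 1) * (int c - 2) \<le> int (s A * (r - s A))"
      by (simp add: algebra_simps)
  qed
  also have "\<dots> = int (2 * card (crossing M K))" unfolding eq by simp
  finally show ?thesis by linarith
qed

text \<open>The number of \<open>r\<close>-sets that meet \<open>c\<close> blocks, \<open>K\<close> among
them, is \<open>O(n^(c-1))\<close>. Such a set has at least \<open>(c - 1)(r + 1)/2\<close> crossing
pairs, so these sets contribute \<open>O(\<kappa>^(c-1))\<close>. Two vertices in \<open>K\<close> force
\<open>c < r\<close>, which is exactly the range in which \<open>crossing_lower\<close> applies.\<close>

lemma sum_crossing:
  fixes y \<kappa> :: real
  assumes V: "finite V" and M: "M \<in> matchings V r a" and K: "K \<in> M" and r: "r \<ge> 3"
    and y: "0 \<le> y" "y \<le> 1" and \<kappa>: "\<kappa> = real (card V) * y ^ (r + 1)" "\<kappa> \<le> 1"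
  shows "(\<Sum>L\<in>{L \<in> nsets V r. L \<noteq> K \<and> 2 \<le> card (L \<inter> K)}. (y ^ 2) ^ card (crossing M L))
    \<le> real r * 2 ^ (r * r) * \<kappa>"
proof -
  let ?S = "{L \<in> nsets V r. L \<noteq> K \<and> 2 \<le> card (L \<inter> K)}"
  let ?n = "card V"
  have dM: "disjoint M" and MV: "M \<subseteq> nsets V r" using M by (auto simp: matchings_def)
  have cM: "card A = r" "A \<subseteq> V" "finite A" if "A \<in> M" for A using MV that by (auto simp: nsets_def)
  define cc where "cc L = card (block M ` L)" for L
  have \<kappa>0: "0 \<le> \<kappa>" using y \<kappa> by simp
  have finS: "finite ?S" using finite_imp_finite_nsets[OF V, of r] by auto
  have L: "2 \<le> cc L" "cc L + 1 \<le> r" "K \<in> block M ` L" if "L \<in> ?S" for L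
  proof -
    have Lr: "card L = r" "finite L" "L \<noteq> K" using that by (auto simp: nsets_def)
    have "\<not> card (L \<inter> K) \<le> Suc 0" using that by auto
    then obtain u v where uv: "u \<in> L \<inter> K" "v \<in> L \<inter> K" "u \<noteq> v"
      using card_le_Suc0_iff_eq[of "L \<inter> K"] Lr(2) by auto
    have cu: "block M u = K" "block M v = K" using block_in[OF dM K] uv by auto
    then show "K \<in> block M ` L" using uv by auto
    have "block M ` L = block M ` (L - {u})" using cu uv by auto
    then have "cc L \<le> card (L - {u})" unfolding cc_def using Lr by (metis card_image_le finite_Diff)
    then show "cc L + 1 \<le> r" using uv Lr r by auto
    have "\<not> L \<subseteq> K" using card_subset_eq[OF cM(3)[OF K], of L] Lr cM(1)[OF K] by auto
    then obtain w where w: "w \<in> L" "w \<notin> K" by auto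
    then have "block M w \<noteq> K" by (auto simp: block_def)
    then have "{K, block M w} \<subseteq> block M ` L" "card {K, block M w} = 2" using cu uv w by auto
    then show "2 \<le> cc L" unfolding cc_def using Lr by (metis card_mono finite_imageI)
  qed
  have fib: "real (card {L \<in> ?S. cc L = c}) \<le> 2 ^ (r * r) * real ?n ^ (c - 1)" if c: "2 \<le> c" "c < r" for c
  proof -
    define CC where "CC = {\<C>. \<C> \<subseteq> block M ` V \<and> K \<in> \<C> \<and> card \<C> = c}"
    have finCC: "finite CC" unfolding CC_def using V by auto
    have "{L \<in> ?S. cc L = c} \<subseteq> (\<Union>\<C>\<in>CC. Pow (\<Union>\<C>))"
    proof
      fix L assume l: "L \<in> {L \<in> ?S. cc L = c}"
      then have "block M ` L \<in> CC" using L(3)[of L] unfolding CC_def cc_def by (auto simp: nsets_def)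
      moreover have "L \<subseteq> \<Union>(block M ` L)" by (auto simp: block_def)
      ultimately show "L \<in> (\<Union>\<C>\<in>CC. Pow (\<Union>\<C>))" by auto
    qed
    moreover have big: "finite (\<Union>\<C>) \<and> card (\<Union>\<C>) \<le> r * r" if "\<C> \<in> CC" for \<C>
    proof -
      have fc: "finite \<C>" using that V unfolding CC_def by (auto intro: finite_subset)
      have cl: "card A \<le> r \<and> finite A" if "A \<in> \<C>" for A
        using that \<open>\<C> \<in> CC\<close> card_block[OF dM cM(1)] r unfolding CC_def by auto
      have "card (\<Union>\<C>) \<le> sum card \<C>" by (rule card_Union_le_sum_card) 
      also have "\<dots> \<le> card \<C> * r" using cl by (intro sum_bounded_above[where 'a=nat, simplified]) auto
      also have "\<dots> \<le> r * r" using that c unfolding CC_def by auto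
      finally show ?thesis using fc cl by auto
    qed
    ultimately have "card {L \<in> ?S. cc L = c} \<le> card (\<Union>\<C>\<in>CC. Pow (\<Union>\<C>))"
      using finCC by (intro card_mono) auto
    also have "\<dots> \<le> (\<Sum>\<C>\<in>CC. card (Pow (\<Union>\<C>)))" by (rule card_UN_le[OF finCC])
    also have "\<dots> \<le> (\<Sum>\<C>\<in>CC. 2 ^ (r * r))"
      by (intro sum_mono) (use big in \<open>auto simp: card_Pow\<close>)
    also have "\<dots> = 2 ^ (r * r) * card CC" by simp
    also have "card CC \<le> card {\<D>. \<D> \<subseteq> block M ` V \<and> card \<D> = c - 1}"
    proof (rule card_inj_on_le[where f = "\<lambda>\<C>. \<C> - {K}"])
      show "inj_on (\<lambda>\<C>. \<C> - {K}) CC" unfolding inj_on_def CC_def by blast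
      show "(\<lambda>\<C>. \<C> - {K}) ` CC \<subseteq> {\<D>. \<D> \<subseteq> block M ` V \<and> card \<D> = c - 1}"
        unfolding CC_def by (auto intro: finite_subset[OF _ finite_imageI[OF V]])
      show "finite {\<D>. \<D> \<subseteq> block M ` V \<and> card \<D> = c - 1}" using V by auto
    qed
    also have "\<dots> = card (block M ` V) choose (c - 1)" using V by (intro n_subsets) auto
    also have "\<dots> \<le> ?n choose (c - 1)" by (intro binomial_right_mono card_image_le V)
    also have "\<dots> \<le> ?n ^ (c - 1)" 
      by (cases "c - 1 \<le> ?n") (auto intro: binomial_le_pow simp: not_le binomial_eq_0)
    finally have "card {L \<in> ?S. cc L = c} \<le> 2 ^ (r * r) * ?n ^ (c - 1)" by simp
    then have "real (card {L \<in> ?S. cc L = c}) \<le> real (2 ^ (r * r) * ?n ^ (c - 1))" by (rule of_nat_mono)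
    then show ?thesis by (simp only: of_nat_mult of_nat_power of_nat_numeral)
  qed
  have "(\<Sum>L\<in>?S. (y ^ 2) ^ card (crossing M L)) \<le> (\<Sum>L\<in>?S. y ^ ((cc L - 1) * (r + 1)))"
  proof (rule sum_mono)
    fix L assume l: "L \<in> ?S"
    have "(y ^ 2) ^ card (crossing M L) = y ^ (2 * card (crossing M L))" by (simp add: power_mult)
    also have "\<dots> \<le> y ^ ((cc L - 1) * (r + 1))"
    proof (rule power_decreasing[OF _ y])
      show "(cc L - 1) * (r + 1) \<le> 2 * card (crossing M L)"
        by (rule crossing_lower[OF dM]) (use l L[OF l] in \<open>auto simp: nsets_def cc_def\<close>)
    qed
    finally show "(y ^ 2) ^ card (crossing M L) \<le> y ^ ((cc L - 1) * (r + 1))" .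
  qed
  also have "\<dots> = (\<Sum>c\<in>{2..<r}. \<Sum>L\<in>{L \<in> ?S. cc L = c}. y ^ ((cc L - 1) * (r + 1)))"
  proof (rule sum.group[symmetric, OF finS])
    show "cc ` ?S \<subseteq> {2..<r}"
    proof (rule image_subsetI)
      fix L assume "L \<in> ?S"
      then show "cc L \<in> {2..<r}" using L(1,2)[of L] by simp
    qed
  qed simp
  also have "\<dots> = (\<Sum>c\<in>{2..<r}. real (card {L \<in> ?S. cc L = c}) * y ^ ((c - 1) * (r + 1)))"
    by (intro sum.cong) auto
  also have "\<dots> \<le> (\<Sum>c\<in>{2..<r}. 2 ^ (r * r) * \<kappa>)"
  proof (rule sum_mono)
    fix c assume c: "c \<in> {2..<r}"
    have "real (card {L \<in> ?S. cc L = c}) * y ^ ((c - 1) * (r + 1)) \<le> (2 ^ (r * r) * real ?n ^ (c - 1)) * y ^ ((c - 1) * (r + 1))"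
      using fib[of c] c y by (intro mult_right_mono) auto
    also have "\<dots> = 2 ^ (r * r) * \<kappa> ^ (c - 1)"
    proof -
      have "y ^ ((c - 1) * (r + 1)) = (y ^ (r + 1)) ^ (c - 1)"
        unfolding power_mult[symmetric] by (simp only: mult.commute)
      then show ?thesis unfolding \<kappa>(1) power_mult_distrib by (simp only: mult.assoc)
    qed
    also have "\<kappa> ^ (c - 1) \<le> \<kappa> ^ 1" using c \<kappa> \<kappa>0 by (intro power_decreasing) auto
    finally show "real (card {L \<in> ?S. cc L = c}) * y ^ ((c - 1) * (r + 1)) \<le> 2 ^ (r * r) * \<kappa>" by simp
  qed
  also have "\<dots> = real (r - 2) * (2 ^ (r * r) * \<kappa>)" by simp
  also have "\<dots> \<le> real r * (2 ^ (r * r) * \<kappa>)" using \<kappa>0 by (intro mult_right_mono) auto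
  finally show ?thesis by (simp add: mult.assoc)
qed

section \<open>Comparing cliques with independent hyperedges\<close>

text \<open>A configuration is a subset \<open>X\<close> of the disjoint union of all pairs and all
\<open>r\<close>-sets of vertices. Its pairs form a graph and its \<open>r\<close>-sets a hypergraph, so the
two extreme cases of the interpolation are \<open>X \<subseteq> E\<close> and
\<open>X \<subseteq> R\<close>.\<close>

locale clique_matching =
  fixes V :: "'a set" and r a :: nat
  assumes finV: "finite V" and r3: "r \<ge> 3"
begin

abbreviation "E \<equiv> nsets V 2"
abbreviation "R \<equiv> nsets V r"
abbreviation "pairs K \<equiv> nsets K 2"

definition avail :: "'a set set \<Rightarrow> 'a set set" where
  "avail X = {K \<in> R. K \<in> X \<or> pairs K \<subseteq> X}"

definition has_matching :: "'a set set \<Rightarrow> bool" where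
  "has_matching X \<longleftrightarrow> (\<exists>M \<in> matchings V r a. M \<subseteq> avail X)"

definition pivotal :: "'a set \<Rightarrow> 'a set set \<Rightarrow> bool" where
  "pivotal i X \<longleftrightarrow> \<not> has_matching (X - {i}) \<and> has_matching (insert i X)"

text \<open>After planting a clique on \<open>K\<close>, no other clique shares an edge with it.\<close>

definition clean :: "'a set \<Rightarrow> 'a set set \<Rightarrow> bool" where
  "clean K X \<longleftrightarrow> (\<forall>L\<in>R. L \<noteq> K \<longrightarrow> 2 \<le> card (L \<inter> K) \<longrightarrow> \<not> pairs L \<subseteq> X \<union> pairs K)"

text \<open>For a clean \<open>K\<close>, the edges inside \<open>K\<close> matter for nothing but
\<open>K\<close> itself, and pivotality of \<open>K\<close> is the following event, which depends neither on
these edges nor on the hyperedge \<open>K\<close> (\<open>clean_pivotal_insensitive\<close>).\<close>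

definition clean_pivotal :: "'a set \<Rightarrow> 'a set set \<Rightarrow> bool" where
  "clean_pivotal K X \<longleftrightarrow> clean K X \<and> \<not> has_matching (X - pairs K - {K}) \<and> has_matching (insert K (X - pairs K))"

lemma finE: "finite E" and finR: "finite R"
  using finV by (auto intro: finite_imp_finite_nsets)

lemma ER_disjoint: "E \<inter> R = {}"
  using r3 by (auto simp: nsets_def)

lemma pairs_not_R: "e \<in> pairs K \<Longrightarrow> e \<notin> R"
  using r3 by (auto simp: nsets_def)

lemma R_not_pairs: "L \<in> R \<Longrightarrow> L \<notin> pairs K"
  using r3 by (auto simp: nsets_def)

lemma pairs_subset_E: "K \<in> R \<Longrightarrow> pairs K \<subseteq> E"
  by (auto simp: nsets_def)

lemma card_pairs: "K \<in> R \<Longrightarrow> card (pairs K) = r choose 2"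
  using card_nsets[of K 2] by (auto simp: nsets_def[of V])

lemma pairs_meet: "e \<in> pairs K \<Longrightarrow> e \<in> pairs L \<Longrightarrow> L \<in> R \<Longrightarrow> 2 \<le> card (L \<inter> K)"
proof -
  assume a: "e \<in> pairs K" "e \<in> pairs L" "L \<in> R"
  then have "finite L" by (auto simp: nsets_def)
  moreover have "e \<subseteq> L \<inter> K" "card e = 2" using a by (auto simp: nsets_def)
  ultimately show ?thesis by (metis card_mono finite_Int)
qed

lemma avail_mono: "X \<subseteq> Y \<Longrightarrow> avail X \<subseteq> avail Y"
  by (auto simp: avail_def)

lemma has_matching_mono: "X \<subseteq> Y \<Longrightarrow> has_matching X \<Longrightarrow> has_matching Y"
  unfolding has_matching_def using avail_mono by blast

lemma has_matching_avail: "avail X \<subseteq> avail Y \<Longrightarrow> has_matching X \<Longrightarrow> has_matching Y"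
  unfolding has_matching_def by blast

text \<open>As soon as one edge of a clean \<open>K\<close> is missing, removing the other edges of
\<open>K\<close> destroys no further available \<open>r\<close>-set.\<close>

lemma avail_clean:
  assumes K: "K \<in> R" "clean K X" and e: "\<not> pairs K \<subseteq> Y" and Y: "Y \<subseteq> X" "K \<notin> Y"
  shows "avail Y \<subseteq> avail (X - pairs K - {K})"
proof
  fix L assume L: "L \<in> avail Y"
  then have LR: "L \<in> R" by (simp add: avail_def)
  have LK: "L \<noteq> K" using L e Y by (auto simp: avail_def)
  show "L \<in> avail (X - pairs K - {K})"
  proof (cases "L \<in> Y")
    case True
    then show ?thesis using LR LK Y R_not_pairs by (auto simp: avail_def)
  next
    case False
    then have p: "pairs L \<subseteq> Y" using L by (simp add: avail_def)
    then have "\<not> 2 \<le> card (L \<inter> K)" using K(2) LR LK Y unfolding clean_def by blast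
    then have "pairs L \<inter> pairs K = {}" using pairs_meet LR by blast
    moreover have "K \<notin> pairs L" using R_not_pairs K by blast
    ultimately show ?thesis using p LR Y by (auto simp: avail_def)
  qed
qed

lemma clean_pivotalI:
  assumes K: "K \<in> R" and p: "pivotal K X" and c: "clean K X"
  shows "clean_pivotal K X"
proof -
  have nf: "\<not> has_matching (X - {K})" and s: "has_matching (insert K X)" using p by (auto simp: pivotal_def)
  have e: "\<not> pairs K \<subseteq> X"
  proof
    assume "pairs K \<subseteq> X"
    then have "avail (insert K X) \<subseteq> avail (X - {K})"
      using R_not_pairs K by (fastforce simp: avail_def)
    then show False using has_matching_avail nf s by blast
  qed
  have 1: "\<not> has_matching (X - pairs K - {K})"
    using nf has_matching_mono[of "X - pairs K - {K}" "X - {K}"] by blast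
  have "avail (insert K X) \<subseteq> avail (insert K (X - pairs K))"
  proof
    fix L assume L: "L \<in> avail (insert K X)"
    show "L \<in> avail (insert K (X - pairs K))"
    proof (cases "L = K")
      case True
      then show ?thesis using K by (simp add: avail_def)
    next
      case False
      then have "L \<in> avail (X - {K})"
        using L R_not_pairs[OF K] by (auto simp: avail_def)
      then have "L \<in> avail (X - pairs K - {K})"
        using avail_clean[OF K c, of "X - {K}"] e by auto
      then show ?thesis using avail_mono[of "X - pairs K - {K}" "insert K (X - pairs K)"] by blast
    qed
  qed
  then have "has_matching (insert K (X - pairs K))" using s has_matching_avail by blast
  then show ?thesis using c 1 by (simp add: clean_pivotal_def)
qed

lemma clean_pivotal_edge:
  assumes K: "K \<in> R" "pairs K \<subseteq> X" "K \<notin> X" "clean_pivotal K X" and e: "e \<in> pairs K"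
  shows "pivotal e X"
proof -
  have c: "clean K X" "\<not> has_matching (X - pairs K - {K})" "has_matching (insert K (X - pairs K))"
    using K by (auto simp: clean_pivotal_def)
  have "avail (X - {e}) \<subseteq> avail (X - pairs K - {K})"
    by (rule avail_clean[OF K(1) c(1)]) (use e K in auto)
  then have 1: "\<not> has_matching (X - {e})" using c(2) has_matching_avail by blast
  have "avail (insert K (X - pairs K)) \<subseteq> avail (insert e X)"
  proof
    fix L assume L: "L \<in> avail (insert K (X - pairs K))"
    have "K \<notin> pairs L" using R_not_pairs K by blast
    then show "L \<in> avail (insert e X)" using L K by (auto simp: avail_def)
  qed
  then show ?thesis using 1 c(3) has_matching_avail by (auto simp: pivotal_def)
qed

lemma clean_pivotal_unique:
  assumes "K \<in> R" "L \<in> R" "pairs L \<subseteq> X" "clean_pivotal K X" "e \<in> pairs K" "e \<in> pairs L"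
  shows "L = K"
  using assms pairs_meet[of e K L] unfolding clean_pivotal_def clean_def by blast

lemma clean_pivotal_insensitive:
  assumes "d \<in> insert K (pairs K)" "K \<in> R"
  shows "clean_pivotal K (insert d X) \<longleftrightarrow> clean_pivotal K X"
proof -
  have "K \<notin> pairs L" for L using R_not_pairs assms by blast
  then have "pairs L \<subseteq> insert d X \<union> pairs K \<longleftrightarrow> pairs L \<subseteq> X \<union> pairs K" for L
    using assms by auto
  moreover have "insert d X - pairs K - {K} = X - pairs K - {K}" using assms by auto
  moreover have "insert K (insert d X - pairs K) = insert K (X - pairs K)" using assms by auto
  ultimately show ?thesis by (simp only: clean_pivotal_def clean_def)
qed

definition coord_prob :: "real \<Rightarrow> real \<Rightarrow> 'a set \<Rightarrow> real" where
  "coord_prob t h i = (if i \<in> E then t else h)"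

text \<open>Plant a clique on a clean pivotal \<open>K\<close> and require the hyperedge \<open>K\<close> to
be absent, which costs \<open>t^m (1 - h)\<close> by independence. All \<open>m\<close> edges of
\<open>K\<close> become pivotal, and an edge arises in this way from one \<open>K\<close> only, as
\<open>K\<close> is the only clique that contains it.\<close>

lemma pivotal_edges_lower:
  assumes t: "0 \<le> t" "t \<le> 1" and h: "0 \<le> h" "h \<le> 1"
  shows "real (r choose 2) * t ^ (r choose 2) * (1 - h) * (\<Sum>K\<in>R. bern_exp (E \<union> R) (coord_prob t h) (\<lambda>X. of_bool (clean_pivotal K X)))
    \<le> t * (\<Sum>e\<in>E. bern_exp (E \<union> R) (coord_prob t h) (\<lambda>X. of_bool (pivotal e X)))"
proof -
  let ?I = "E \<union> R" and ?q = "coord_prob t h" and ?m = "r choose 2"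
  have finI: "finite ?I" using finE finR by auto
  have q01: "0 \<le> ?q i \<and> ?q i \<le> 1" for i using t h by (auto simp: coord_prob_def)
  define C where "C K X \<longleftrightarrow> pairs K \<subseteq> X \<and> K \<notin> X \<and> clean_pivotal K X" for K X
  have C: "bern_exp ?I ?q (\<lambda>X. of_bool (C K X)) = t ^ ?m * (1 - h) * bern_exp ?I ?q (\<lambda>X. of_bool (clean_pivotal K X))"
    if K: "K \<in> R" for K
  proof -
    have KE: "K \<notin> E" using K ER_disjoint by auto
    have "bern_exp ?I ?q (\<lambda>X. of_bool (C K X)) = bern_exp ?I ?q (\<lambda>X. of_bool (pairs K \<subseteq> X) * (of_bool (K \<notin> X) * of_bool (clean_pivotal K X)))"
      by (intro bern_exp_cong) (auto simp: C_def)
    also have "\<dots> = (\<Prod>d\<in>pairs K. ?q d) * bern_exp ?I ?q (\<lambda>X. of_bool (K \<notin> X) * of_bool (clean_pivotal K X))"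
    proof (rule bern_exp_subset_indep[OF finI])
      show "pairs K \<subseteq> ?I" using pairs_subset_E K by auto
      fix X d assume "d \<in> pairs K"
      moreover have "K \<noteq> d" using R_not_pairs[OF K] calculation by auto
      ultimately show "of_bool (K \<notin> insert d X) * of_bool (clean_pivotal K (insert d X)) = (of_bool (K \<notin> X) * of_bool (clean_pivotal K X) :: real)"
        using clean_pivotal_insensitive[of d K X] K by auto
    qed
    also have "(\<Prod>d\<in>pairs K. ?q d) = (\<Prod>d\<in>pairs K. t)"
      by (intro prod.cong) (use pairs_subset_E[OF K] in \<open>auto simp: coord_prob_def\<close>)
    also have "\<dots> = t ^ ?m" using card_pairs[OF K] by simp
    also have "bern_exp ?I ?q (\<lambda>X. of_bool (K \<notin> X) * of_bool (clean_pivotal K X)) = (1 - ?q K) * bern_exp ?I ?q (\<lambda>X. of_bool (clean_pivotal K X))"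
      by (rule bern_exp_coord(2)[OF finI]) (use K clean_pivotal_insensitive[of K K] in auto)
    moreover have "?q K = h" using KE by (simp add: coord_prob_def)
    ultimately show ?thesis by simp
  qed
  have "real ?m * t ^ ?m * (1 - h) * (\<Sum>K\<in>R. bern_exp ?I ?q (\<lambda>X. of_bool (clean_pivotal K X)))
     = (\<Sum>K\<in>R. real ?m * bern_exp ?I ?q (\<lambda>X. of_bool (C K X)))"
    unfolding sum_distrib_left by (intro sum.cong refl) (simp add: C)
  also have "\<dots> = (\<Sum>K\<in>R. \<Sum>e\<in>E. of_bool (e \<in> pairs K) * bern_exp ?I ?q (\<lambda>X. of_bool (C K X)))"
  proof (rule sum.cong)
    fix K assume K: "K \<in> R"
    have "E \<inter> {e. e \<in> pairs K} = pairs K" using pairs_subset_E[OF K] by auto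
    then have "(\<Sum>e\<in>E. of_bool (e \<in> pairs K)) = real ?m" using finE card_pairs[OF K] by simp
    then show "real ?m * bern_exp ?I ?q (\<lambda>X. of_bool (C K X)) = (\<Sum>e\<in>E. of_bool (e \<in> pairs K) * bern_exp ?I ?q (\<lambda>X. of_bool (C K X)))"
      by (simp flip: sum_distrib_right)
  qed simp
  also have "\<dots> = (\<Sum>e\<in>E. bern_exp ?I ?q (\<lambda>X. \<Sum>K\<in>R. of_bool (e \<in> pairs K) * of_bool (C K X)))"
    unfolding bern_exp_sum bern_exp_cmult by (rule sum.swap)
  also have "\<dots> \<le> (\<Sum>e\<in>E. bern_exp ?I ?q (\<lambda>X. of_bool (e \<in> X) * of_bool (pivotal e X)))"
  proof (intro sum_mono bern_exp_mono q01)
    fix e X assume e: "e \<in> E" and X: "X \<subseteq> ?I"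
    let ?J = "{K \<in> R. e \<in> pairs K \<and> C K X}"
    have "(\<Sum>K\<in>R. of_bool (e \<in> pairs K) * of_bool (C K X)) = (real (card ?J))"
      using finR by (simp flip: of_bool_conj add: Int_def)
    also have "\<dots> \<le> of_bool (e \<in> X) * of_bool (pivotal e X)"
    proof (cases "?J = {}")
      case False
      then obtain K where K: "K \<in> ?J" by auto
      then have "pivotal e X" "e \<in> X" using clean_pivotal_edge[of K X e] by (auto simp: C_def)
      moreover have "?J = {K}"
      proof -
        have "L = K" if "L \<in> ?J" for L
          using clean_pivotal_unique[of K L X e] K that by (auto simp: C_def)
        then show ?thesis using K by blast
      qed
      ultimately show ?thesis by simp
    next
      case True
      then show ?thesis by (simp only: card.empty) simp
    qed
    finally show "(\<Sum>K\<in>R. of_bool (e \<in> pairs K) * of_bool (C K X)) \<le> (of_bool (e \<in> X) * of_bool (pivotal e X) :: real)" .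
  qed
  also have "\<dots> = (\<Sum>e\<in>E. t * bern_exp ?I ?q (\<lambda>X. of_bool (pivotal e X)))"
  proof (rule sum.cong)
    fix e assume e: "e \<in> E"
    have "bern_exp ?I ?q (\<lambda>X. of_bool (e \<in> X) * of_bool (pivotal e X)) = ?q e * bern_exp ?I ?q (\<lambda>X. of_bool (pivotal e X))"
      by (rule bern_exp_coord(1)[OF finI]) (use e in \<open>auto simp: pivotal_def\<close>)
    then show "bern_exp ?I ?q (\<lambda>X. of_bool (e \<in> X) * of_bool (pivotal e X)) = t * bern_exp ?I ?q (\<lambda>X. of_bool (pivotal e X))"
      using e by (simp add: coord_prob_def)
  qed simp
  finally show ?thesis by (simp add: sum_distrib_left)
qed

text \<open>Let \<open>L\<close> be a clique that would share an edge with \<open>K\<close>, and let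
\<open>M\<close> be the canonical matching containing \<open>K\<close>. All crossing pairs of
\<open>L\<close> are edges, and deleting them keeps \<open>M\<close> available, hence keeps \<open>K\<close>
pivotal; it also keeps \<open>M\<close> canonical because \<open>M\<close> is least for a fixed order. The
odds of an edge are at most \<open>2 t\<close>, so every \<open>L\<close> costs a factor
\<open>(2 t)^|crossing M L|\<close>, and \<open>sum_crossing\<close> adds these costs up.\<close>

lemma pivotal_not_clean:
  fixes y \<kappa> :: real
  assumes t: "0 \<le> t" "t \<le> 1 / 2" and h: "0 \<le> h" "h \<le> 1"
    and y: "y ^ 2 = 2 * t" "0 \<le> y" and \<kappa>: "\<kappa> = real (card V) * y ^ (r + 1)" "\<kappa> \<le> 1"
    and K: "K \<in> R"
  shows "bern_exp (E \<union> R) (coord_prob t h) (\<lambda>X. of_bool (pivotal K X \<and> \<not> clean K X))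
    \<le> (real r * 2 ^ (r * r) * \<kappa>) * bern_exp (E \<union> R) (coord_prob t h) (\<lambda>X. of_bool (pivotal K X))"
proof -
  let ?I = "E \<union> R" and ?q = "coord_prob t h"
  let ?MM = "matchings V r a"
  have finI: "finite ?I" using finE finR by auto
  have q01: "0 \<le> ?q i \<and> ?q i \<le> 1" for i using t h by (auto simp: coord_prob_def)
  have y1: "y \<le> 1"
  proof (rule ccontr)
    assume "\<not> y \<le> 1"
    then have "1 < y ^ 2" by (simp add: one_less_power)
    then show False using y t by simp
  qed
  have finM: "finite ?MM" using finite_matchings finV by auto
  \<comment> \<open>a linear order on the matchings, which makes the least available one canonical\<close>
  obtain f :: "'a set set \<Rightarrow> nat" where f: "inj_on f ?MM"
    using finite_imp_inj_to_nat_seg[OF finM] by metis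
  define canon where "canon X = arg_min_on f {M \<in> ?MM. M \<subseteq> avail (insert K X)}" for X
  have canon: "canon X \<in> ?MM \<and> canon X \<subseteq> avail (insert K X) \<and> (\<forall>M\<in>?MM. M \<subseteq> avail (insert K X) \<longrightarrow> f (canon X) \<le> f M)"
    if "has_matching (insert K X)" for X
    using arg_min_if_finite[of "{M \<in> ?MM. M \<subseteq> avail (insert K X)}" f] that finM
    unfolding canon_def[symmetric] has_matching_def by (auto simp: not_less)
  have Kcanon: "K \<in> canon X" if p: "pivotal K X" for X
  proof (rule ccontr)
    assume n: "K \<notin> canon X"
    have c: "canon X \<in> ?MM" "canon X \<subseteq> avail (insert K X)" using canon[of X] p by (auto simp: pivotal_def)
    have "canon X \<subseteq> avail (X - {K})"
      using c(2) n R_not_pairs[OF K] by (fastforce simp: avail_def)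
    then show False using c(1) p by (auto simp: pivotal_def has_matching_def)
  qed
  have remove: "pivotal K (X - D) \<and> canon (X - D) = M"
    if p: "pivotal K X" and cM: "canon X = M" and D: "D = crossing M L" "L \<in> R" for X M L D
  proof -
    have c: "M \<in> ?MM" "M \<subseteq> avail (insert K X)" "\<And>M'. M' \<in> ?MM \<Longrightarrow> M' \<subseteq> avail (insert K X) \<Longrightarrow> f M \<le> f M'"
      using canon[of X] p cM by (auto simp: pivotal_def)
    have DE: "D \<inter> R = {}" using D pairs_not_R by (auto simp: crossing_def)
    have MX: "M \<subseteq> avail (insert K (X - D))"
    proof
      fix A assume A: "A \<in> M"
      then have AR: "A \<in> R" "A \<in> avail (insert K X)" using c by (auto simp: avail_def)
      have "pairs A \<inter> D = {}" using A D by (auto simp: crossing_def nsets_def)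
      moreover have "A \<notin> D" using AR DE by auto
      moreover have "K \<notin> pairs A" using R_not_pairs K by blast
      ultimately show "A \<in> avail (insert K (X - D))" using AR by (auto simp: avail_def)
    qed
    then have s: "has_matching (insert K (X - D))" using c(1) by (auto simp: has_matching_def)
    have "\<not> has_matching (X - D - {K})" using p has_matching_mono[of "X - D - {K}" "X - {K}"] by (auto simp: pivotal_def)
    then have p': "pivotal K (X - D)" using s by (simp add: pivotal_def)
    have c': "canon (X - D) \<in> ?MM" "canon (X - D) \<subseteq> avail (insert K (X - D))" "f (canon (X - D)) \<le> f M"
      using canon[OF s] c(1) MX by auto
    have "avail (insert K (X - D)) \<subseteq> avail (insert K X)" by (rule avail_mono) auto
    then have "f M \<le> f (canon (X - D))" using c(3)[OF c'(1)] c'(2) by blast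
    then have "canon (X - D) = M" using c'(1,3) c(1) f by (simp add: inj_on_def)
    then show ?thesis using p' by simp
  qed
  define MK where "MK = {M \<in> ?MM. K \<in> M}"
  define LL where "LL = {L \<in> R. L \<noteq> K \<and> 2 \<le> card (L \<inter> K)}"
  have fin: "finite MK" "finite LL" using finM finR by (auto simp: MK_def LL_def)
  let ?pc = "\<lambda>M X. of_bool (pivotal K X \<and> canon X = M) :: real"
  have "bern_exp ?I ?q (\<lambda>X. of_bool (pivotal K X \<and> \<not> clean K X))
    \<le> (\<Sum>z\<in>MK \<times> LL. bern_exp ?I ?q (\<lambda>X. of_bool (crossing (fst z) (snd z) \<subseteq> X \<and> pivotal K X \<and> canon X = fst z)))"
  proof (rule bern_exp_union_bound[OF q01])
    fix X assume X: "X \<subseteq> ?I" "pivotal K X \<and> \<not> clean K X"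
    then obtain L where L: "L \<in> LL" "pairs L \<subseteq> X \<union> pairs K" by (auto simp: clean_def LL_def)
    have M: "canon X \<in> MK" using canon[of X] Kcanon[of X] X by (auto simp: MK_def pivotal_def)
    have "crossing (canon X) L \<subseteq> X"
    proof
      fix e assume e: "e \<in> crossing (canon X) L"
      then have "e \<notin> pairs K" using M by (auto simp: crossing_def MK_def nsets_def)
      then show "e \<in> X" using e L by (auto simp: crossing_def)
    qed
    then show "\<exists>z\<in>MK \<times> LL. crossing (fst z) (snd z) \<subseteq> X \<and> pivotal K X \<and> canon X = fst z"
      using L M X by (intro bexI[of _ "(canon X, L)"]) auto
  qed (use fin in auto)
  also have "\<dots> = (\<Sum>M\<in>MK. \<Sum>L\<in>LL. bern_exp ?I ?q (\<lambda>X. of_bool (crossing M L \<subseteq> X) * ?pc M X))"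
    by (simp add: sum.cartesian_product case_prod_unfold of_bool_conj)
  also have "\<dots> \<le> (\<Sum>M\<in>MK. \<Sum>L\<in>LL. (y ^ 2) ^ card (crossing M L) * bern_exp ?I ?q (?pc M))"
  proof (intro sum_mono)
    fix M L assume M: "M \<in> MK" and L: "L \<in> LL"
    have LR: "L \<in> R" using L by (simp add: LL_def)
    have sub: "crossing M L \<subseteq> E" using pairs_subset_E[OF LR] by (auto simp: crossing_def)
    show "bern_exp ?I ?q (\<lambda>X. of_bool (crossing M L \<subseteq> X) * ?pc M X) \<le> (y ^ 2) ^ card (crossing M L) * bern_exp ?I ?q (?pc M)"
    proof (rule bern_exp_delete[OF finI _ q01])
      show "crossing M L \<subseteq> ?I" using sub by auto
      fix d assume "d \<in> crossing M L"
      then have "?q d = t" using sub by (auto simp: coord_prob_def)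
      moreover have "t \<le> 2 * t * (1 - t)" using t mult_left_mono[of t "1/2" t] by (simp add: algebra_simps)
      ultimately show "?q d \<le> y ^ 2 * (1 - ?q d)" using y by simp
    next
      fix X
      show "?pc M X \<le> ?pc M (X - crossing M L)" using remove[of X M "crossing M L" L] LR by auto
    qed auto
  qed
  also have "\<dots> = (\<Sum>M\<in>MK. (\<Sum>L\<in>LL. (y ^ 2) ^ card (crossing M L)) * bern_exp ?I ?q (?pc M))"
    by (simp add: sum_distrib_right)
  also have "\<dots> \<le> (\<Sum>M\<in>MK. (real r * 2 ^ (r * r) * \<kappa>) * bern_exp ?I ?q (?pc M))"
  proof (intro sum_mono mult_right_mono)
    fix M assume "M \<in> MK"
    then show "(\<Sum>L\<in>LL. (y ^ 2) ^ card (crossing M L)) \<le> real r * 2 ^ (r * r) * \<kappa>"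
      unfolding LL_def MK_def using sum_crossing[OF finV _ _ r3 y(2) y1 \<kappa>, of M a K] by auto
    show "0 \<le> bern_exp ?I ?q (?pc M)" by (intro bern_exp_nonneg q01) auto
  qed
  also have "\<dots> = (real r * 2 ^ (r * r) * \<kappa>) * bern_exp ?I ?q (\<lambda>X. \<Sum>M\<in>MK. ?pc M X)"
    by (simp add: bern_exp_sum sum_distrib_left)
  also have "bern_exp ?I ?q (\<lambda>X. \<Sum>M\<in>MK. ?pc M X) = bern_exp ?I ?q (\<lambda>X. of_bool (pivotal K X))"
  proof (rule bern_exp_cong)
    fix X
    show "(\<Sum>M\<in>MK. ?pc M X) = of_bool (pivotal K X)"
    proof (cases "pivotal K X")
      case True
      then have "canon X \<in> MK" using canon[of X] Kcanon[of X] by (auto simp: MK_def pivotal_def)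
      then have "MK \<inter> {M. canon X = M} = {canon X}" by auto
      then show ?thesis using True fin by simp
    qed simp
  qed
  finally show ?thesis .
qed

text \<open>At least half of the influence of the \<open>r\<close>-sets comes from configurations in which
they are clean, and the hyperedge is absent with probability \<open>1 - h \<ge> 1/2\<close>. These are
the two halves in the factor \<open>1/4\<close>.\<close>

lemma pivotal_comparison:
  fixes y \<kappa> :: real
  assumes t: "0 < t" "t \<le> 1 / 2" and h: "0 \<le> h" "h \<le> 1 / 2"
    and y: "y ^ 2 = 2 * t" "0 \<le> y" and \<kappa>: "real r * 2 ^ (r * r) * (real (card V) * y ^ (r + 1)) \<le> 1 / 2"
  shows "(1 / 4) * (real (r choose 2) * t ^ ((r choose 2) - 1)) * (\<Sum>K\<in>R. bern_exp (E \<union> R) (coord_prob t h) (\<lambda>X. of_bool (pivotal K X)))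
    \<le> (\<Sum>e\<in>E. bern_exp (E \<union> R) (coord_prob t h) (\<lambda>X. of_bool (pivotal e X)))"
proof -
  let ?I = "E \<union> R" and ?q = "coord_prob t h" and ?m = "r choose 2"
  define \<kappa>' where "\<kappa>' = real (card V) * y ^ (r + 1)"
  have \<kappa>0: "0 \<le> \<kappa>'" unfolding \<kappa>'_def using y by simp
  have q01: "0 \<le> ?q i \<and> ?q i \<le> 1" for i using t h by (auto simp: coord_prob_def)
  have "1 * \<kappa>' \<le> real r * 2 ^ (r * r) * \<kappa>'"
  proof (rule mult_right_mono[OF _ \<kappa>0])
    have "1 * 1 \<le> real r * 2 ^ (r * r)" using r3 by (intro mult_mono) auto
    then show "1 \<le> real r * 2 ^ (r * r)" by simp
  qed
  then have \<kappa>1: "\<kappa>' \<le> 1" using \<kappa> unfolding \<kappa>'_def by linarith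
  let ?S = "\<Sum>K\<in>R. bern_exp ?I ?q (\<lambda>X. of_bool (pivotal K X))"
  let ?L = "\<Sum>K\<in>R. bern_exp ?I ?q (\<lambda>X. of_bool (clean_pivotal K X))"
  let ?P = "\<Sum>e\<in>E. bern_exp ?I ?q (\<lambda>X. of_bool (pivotal e X))"
  have Snn: "0 \<le> ?S" by (intro sum_nonneg bern_exp_nonneg q01) auto
  have Lnn: "0 \<le> ?L" by (intro sum_nonneg bern_exp_nonneg q01) auto
  have "?S \<le> 2 * ?L" unfolding sum_distrib_left
  proof (rule sum_mono)
    fix K assume K: "K \<in> R"
    let ?p = "bern_exp ?I ?q (\<lambda>X. of_bool (pivotal K X))"
    have p0: "0 \<le> ?p" by (intro bern_exp_nonneg q01) auto
    have "?p \<le> bern_exp ?I ?q (\<lambda>X. of_bool (pivotal K X \<and> \<not> clean K X) + of_bool (clean_pivotal K X))"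
      by (intro bern_exp_mono q01) (use clean_pivotalI[OF K] in auto)
    also have "\<dots> = bern_exp ?I ?q (\<lambda>X. of_bool (pivotal K X \<and> \<not> clean K X)) + bern_exp ?I ?q (\<lambda>X. of_bool (clean_pivotal K X))"
      by (rule bern_exp_add)
    also have "bern_exp ?I ?q (\<lambda>X. of_bool (pivotal K X \<and> \<not> clean K X)) \<le> (real r * 2 ^ (r * r) * \<kappa>') * ?p"
      by (rule pivotal_not_clean[OF _ t(2) h(1) _ y \<kappa>'_def \<kappa>1 K]) (use t h in auto)
    also have "\<dots> \<le> (1 / 2) * ?p" using \<kappa> p0 unfolding \<kappa>'_def by (intro mult_right_mono) auto
    finally show "?p \<le> 2 * bern_exp ?I ?q (\<lambda>X. of_bool (clean_pivotal K X))" by simp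
  qed
  then have "(1 / 4) * (real ?m * t ^ ?m) * ?S \<le> (1 / 4) * (real ?m * t ^ ?m) * (2 * ?L)"
    using t by (intro mult_left_mono) auto
  also have "\<dots> = real ?m * t ^ ?m * (1 / 2) * ?L" by simp
  also have "\<dots> \<le> real ?m * t ^ ?m * (1 - h) * ?L"
    using t h Lnn by (intro mult_right_mono mult_left_mono) auto
  also have "\<dots> \<le> t * ?P" by (rule pivotal_edges_lower) (use t h in auto)
  finally have 1: "(1 / 4) * (real ?m * t ^ ?m) * ?S \<le> t * ?P" .
  have "?m \<ge> 1" using r3 binomial_eq_0_iff[of r 2] by linarith
  then have "t ^ ?m = t * t ^ (?m - 1)" by (cases ?m) auto
  then have "t * ((1 / 4) * (real ?m * t ^ (?m - 1)) * ?S) \<le> t * ?P" using 1 by (simp add: algebra_simps)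
  then show ?thesis using t by simp
qed

text \<open>The failure probability does not increase along the curve on which edges have probability
\<open>t\<close> and hyperedges have probability \<open>(P^m - t^m)/4\<close>: its derivative there is a
combination of influences whose sign follows from \<open>pivotal_comparison\<close>. The endpoints are the
random hypergraph at \<open>t = 0\<close> and the random graph at \<open>t = P\<close>.\<close>

theorem clique_comparison:
  fixes P y :: real
  assumes P: "0 \<le> P" "P \<le> 1 / 2"
    and y: "y ^ 2 = 2 * P" "0 \<le> y" and \<kappa>: "real r * 2 ^ (r * r) * (real (card V) * y ^ (r + 1)) \<le> 1 / 2"
  shows "bern_exp E (\<lambda>_. P) (\<lambda>X. of_bool (\<not> has_matching X)) \<le> bern_exp R (\<lambda>_. P ^ (r choose 2) / 4) (\<lambda>X. of_bool (\<not> has_matching X))"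
proof -
  let ?I = "E \<union> R" and ?m = "r choose 2"
  have finI: "finite ?I" using finE finR by auto
  have m3: "?m \<ge> 2"
  proof -
    have "3 choose 2 \<le> ?m" by (rule binomial_right_mono) (use r3 in auto)
    then show ?thesis by (simp add: numeral_eq_Suc)
  qed
  define hh where "hh t = (P ^ ?m - t ^ ?m) / 4" for t
  define F where "F t = bern_exp ?I (coord_prob t (hh t)) (\<lambda>X. of_bool (\<not> has_matching X))" for t
  have hh: "0 \<le> hh t" "hh t \<le> 1 / 2" if "0 \<le> t" "t \<le> P" for t
  proof -
    show "0 \<le> hh t" unfolding hh_def using power_mono[of t P ?m] that by simp
    have "P ^ ?m \<le> 1" using P by (intro power_le_one) auto
    moreover have "0 \<le> t ^ ?m" using that by simp
    ultimately show "hh t \<le> 1 / 2" unfolding hh_def by simp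
  qed
  have "F P \<le> F 0"
  proof (rule DERIV_nonpos_imp_nonincreasing[OF P(1)])
    fix t assume t: "0 \<le> t" "t \<le> P"
    \<comment> \<open>the derivatives of the coordinate probabilities at \<open>t\<close>\<close>
    define q' where "q' i = (if i \<in> E then 1 else - (real ?m * t ^ (?m - 1)) / 4)" for i :: "'a set"
    have q01: "0 \<le> coord_prob t (hh t) i \<and> coord_prob t (hh t) i \<le> 1" for i
      using t P hh[OF t] by (auto simp: coord_prob_def)
    have D: "(F has_real_derivative (\<Sum>i\<in>?I. q' i * bern_exp ?I (coord_prob t (hh t))
        (\<lambda>X. of_bool (\<not> has_matching (insert i X)) - of_bool (\<not> has_matching (X - {i}))))) (at t)"
      unfolding F_def
    proof (rule russo_formula[OF finI])
      fix i assume i: "i \<in> ?I"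
      show "((\<lambda>t. coord_prob t (hh t) i) has_real_derivative q' i) (at t)"
      proof (cases "i \<in> E")
        case True
        then show ?thesis by (simp add: coord_prob_def q'_def)
      next
        case False
        have "(hh has_real_derivative - (real ?m * t ^ (?m - 1)) / 4) (at t)"
          unfolding hh_def by (auto intro!: derivative_eq_intros)
        then show ?thesis using False by (simp add: coord_prob_def q'_def)
      qed
    qed
    have pv: "bern_exp ?I (coord_prob t (hh t)) (\<lambda>X. of_bool (\<not> has_matching (insert i X)) - of_bool (\<not> has_matching (X - {i})))
       = - bern_exp ?I (coord_prob t (hh t)) (\<lambda>X. of_bool (pivotal i X))" for i
    proof -
      have "bern_exp ?I (coord_prob t (hh t)) (\<lambda>X. of_bool (\<not> has_matching (insert i X)) - of_bool (\<not> has_matching (X - {i})))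
        = bern_exp ?I (coord_prob t (hh t)) (\<lambda>X. (-1) * of_bool (pivotal i X))"
      proof (rule bern_exp_cong)
        fix X
        have "has_matching (X - {i}) \<Longrightarrow> has_matching (insert i X)" by (rule has_matching_mono[of "X - {i}"]) auto
        then show "of_bool (\<not> has_matching (insert i X)) - of_bool (\<not> has_matching (X - {i})) = (-1) * (of_bool (pivotal i X) :: real)"
          by (auto simp: pivotal_def)
      qed
      then show ?thesis unfolding bern_exp_cmult by simp
    qed
    let ?S = "\<Sum>K\<in>R. bern_exp ?I (coord_prob t (hh t)) (\<lambda>X. of_bool (pivotal K X))"
    let ?P = "\<Sum>e\<in>E. bern_exp ?I (coord_prob t (hh t)) (\<lambda>X. of_bool (pivotal e X))"
    have "(\<Sum>i\<in>?I. q' i * bern_exp ?I (coord_prob t (hh t)) (\<lambda>X. of_bool (\<not> has_matching (insert i X)) - of_bool (\<not> has_matching (X - {i}))))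
      = (\<Sum>i\<in>E. q' i * - bern_exp ?I (coord_prob t (hh t)) (\<lambda>X. of_bool (pivotal i X))) + (\<Sum>i\<in>R. q' i * - bern_exp ?I (coord_prob t (hh t)) (\<lambda>X. of_bool (pivotal i X)))"
      unfolding pv by (rule sum.union_disjoint[OF finE finR ER_disjoint])
    also have "(\<Sum>i\<in>E. q' i * - bern_exp ?I (coord_prob t (hh t)) (\<lambda>X. of_bool (pivotal i X))) = - ?P"
      by (simp add: q'_def sum_negf)
    also have "(\<Sum>i\<in>R. q' i * - bern_exp ?I (coord_prob t (hh t)) (\<lambda>X. of_bool (pivotal i X))) = (1/4) * (real ?m * t ^ (?m - 1)) * ?S"
    proof -
      have "(\<Sum>i\<in>R. q' i * - bern_exp ?I (coord_prob t (hh t)) (\<lambda>X. of_bool (pivotal i X)))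
         = (\<Sum>i\<in>R. ((1/4) * (real ?m * t ^ (?m - 1))) * bern_exp ?I (coord_prob t (hh t)) (\<lambda>X. of_bool (pivotal i X)))"
        by (intro sum.cong) (use ER_disjoint in \<open>auto simp: q'_def\<close>)
      then show ?thesis by (simp only: sum_distrib_left)
    qed
    also have "- ?P + (1/4) * (real ?m * t ^ (?m - 1)) * ?S \<le> 0"
    proof (cases "t = 0")
      case True
      moreover have "0 \<le> ?P" by (intro sum_nonneg bern_exp_nonneg q01) auto
      moreover have "(0::real) ^ (?m - 1) = 0" using m3 by simp
      ultimately show ?thesis by (simp only: mult_zero_left mult_zero_right)
    next
      case False
      \<comment> \<open>the smallness assumption at \<open>P\<close> is inherited by all smaller \<open>t\<close>\<close>
      define z where "z = sqrt (2 * t)"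
      have z: "z ^ 2 = 2 * t" "0 \<le> z" using t by (auto simp: z_def)
      have "z ^ 2 \<le> y ^ 2" using z y t by simp
      then have "z \<le> y" using y(2) by (rule power2_le_imp_le)
      then have "real r * 2 ^ (r * r) * (real (card V) * z ^ (r + 1)) \<le> real r * 2 ^ (r * r) * (real (card V) * y ^ (r + 1))"
        using z by (intro mult_left_mono power_mono) auto
      then have "real r * 2 ^ (r * r) * (real (card V) * z ^ (r + 1)) \<le> 1 / 2" using \<kappa> by linarith
      from pivotal_comparison[OF _ _ hh[OF t] z this] t P False show ?thesis by auto
    qed
    finally show "\<exists>y. (F has_real_derivative y) (at t) \<and> y \<le> 0" using D by blast
  qed
  moreover have "F P = bern_exp E (\<lambda>_. P) (\<lambda>X. of_bool (\<not> has_matching X))"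
  proof -
    have "F P = bern_exp E (coord_prob P (hh P)) (\<lambda>X. of_bool (\<not> has_matching X))"
      unfolding F_def by (rule bern_exp_zero_coords[OF finE finR ER_disjoint])
        (use ER_disjoint in \<open>auto simp: coord_prob_def hh_def\<close>)
    also have "\<dots> = bern_exp E (\<lambda>_. P) (\<lambda>X. of_bool (\<not> has_matching X))"
      unfolding bern_exp_def bern_weight_def by (intro sum.cong arg_cong2[where f="(*)"] prod.cong) (auto simp: coord_prob_def)
    finally show ?thesis .
  qed
  moreover have "F 0 = bern_exp R (\<lambda>_. P ^ ?m / 4) (\<lambda>X. of_bool (\<not> has_matching X))"
  proof -
    have "F 0 = bern_exp (R \<union> E) (coord_prob 0 (hh 0)) (\<lambda>X. of_bool (\<not> has_matching X))" unfolding F_def by (simp add: Un_commute)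
    also have "\<dots> = bern_exp R (coord_prob 0 (hh 0)) (\<lambda>X. of_bool (\<not> has_matching X))"
      by (rule bern_exp_zero_coords[OF finR finE]) (use ER_disjoint in \<open>auto simp: coord_prob_def\<close>)
    also have "\<dots> = bern_exp R (\<lambda>_. P ^ ?m / 4) (\<lambda>X. of_bool (\<not> has_matching X))"
      unfolding bern_exp_def bern_weight_def using m3
      by (intro sum.cong arg_cong2[where f="(*)"] prod.cong) (use ER_disjoint r3 in \<open>auto simp: coord_prob_def hh_def\<close>)
    finally show ?thesis .
  qed
  ultimately show ?thesis by simp
qed

end

section \<open>Failure probabilities in hypergraphs and graphs\<close>

context clique_matching
begin

text \<open>If \<open>X\<close> has no matching of size \<open>a\<close>, it misses every
\<open>l\<close>-matching by at least \<open>l - a + 1\<close> hyperedges. So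
\<open>bad_after_rounds\<close> applies to the uniform \<open>l\<close>-matching, with \<open>k\<close>
rounds whose density is \<open>2304\<close> times the spread \<open>r! 3^r / n^(r-1)\<close>.\<close>

lemma hypergraph_bound:
  assumes V: "card V > 0" and l: "r * l \<le> card V" "a \<le> l"
    and h: "2304 * (fact r * 3 ^ r / real (card V) ^ (r - 1)) \<le> 1"
    and k: "real k * (2304 * (fact r * 3 ^ r / real (card V) ^ (r - 1))) \<le> h" "h \<le> 1"
  shows "bern_exp R (\<lambda>_. h) (\<lambda>X. of_bool (\<not> has_matching X)) \<le> (real (card V) * (1/3) ^ k) ^ (l - a + 1)"
proof -
  let ?n = "card V"
  define \<sigma> :: real where "\<sigma> = fact r * 3 ^ r / real ?n ^ (r - 1)"
  define h1 where "h1 = 2304 * \<sigma>"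
  define q where "q = l - a + 1"
  let ?F = "matchings V r l"
  have \<sigma>: "\<sigma> > 0" unfolding \<sigma>_def using V by simp
  have h1: "0 < h1" "h1 \<le> 1" using \<sigma> h unfolding h1_def \<sigma>_def by auto
  interpret spread_family R ?F "\<lambda>F. F" \<sigma> h1
  proof
    show "finite R" by (rule finR)
    show "finite ?F" using finV finite_matchings by blast
    show "?F \<noteq> {}" by (rule matchings_nonempty) (use finV r3 l in auto)
    show "F \<subseteq> R" if "F \<in> ?F" for F using that by (auto simp: matchings_def)
    show "real (card {F \<in> ?F. T \<subseteq> F}) \<le> \<sigma> ^ card T * real (card ?F)" if "T \<subseteq> R" for T
      unfolding \<sigma>_def by (rule matchings_spread) (use finV V r3 l that in auto)
  qed (use h1 \<sigma> in auto)
  have cF: "card F = l" if "F \<in> ?F" for F using that by (auto simp: matchings_def)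
  have cp: "real (card ?F) > 0" using finF neF by (simp add: card_gt_0_iff)
  have bad: "bad q (\<lambda>F. F) X" if "\<not> has_matching X" for X
    unfolding bad_def
  proof (rule ballI, rule ccontr)
    fix F assume F: "F \<in> ?F" "\<not> q \<le> card (F - X)"
    have fF: "finite F" using F(1) finR by (auto simp: matchings_def intro: finite_subset)
    have "card F = card (F - X) + card (F \<inter> X)"
      using card_Int_Diff[OF fF, of X] by simp
    then have "a \<le> card (F \<inter> X)" using F(2) cF[OF F(1)] l(2) unfolding q_def by linarith
    then obtain M where M: "M \<subseteq> F \<inter> X" "card M = a" by (rule obtain_subset_with_card_n)
    then have "M \<in> matchings V r a" using F(1) by (auto simp: matchings_def intro: pairwise_subset)
    moreover have "M \<subseteq> avail X" using M F(1) by (auto simp: avail_def matchings_def)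
    ultimately show False using that by (auto simp: has_matching_def)
  qed
  have "1 - (1 - h1) ^ k \<le> real k * h1"
    using Bernoulli_inequality[of "- h1" k] h1 by (simp add: algebra_simps)
  then have kh: "1 - (1 - h1) ^ k \<le> h" using k unfolding h1_def \<sigma>_def by linarith
  have pk: "0 \<le> 1 - (1 - h1) ^ k" using h1 by (simp add: power_le_one)
  have "bern_exp R (\<lambda>_. h) (\<lambda>X. of_bool (\<not> has_matching X)) \<le> bern_exp R (\<lambda>_. 1 - (1 - h1) ^ k) (\<lambda>X. of_bool (\<not> has_matching X))"
    by (rule bern_exp_antimono[OF finR]) (use kh k pk has_matching_mono in auto)
  also have "\<dots> \<le> bern_exp R (\<lambda>_. 1 - (1 - h1) ^ k) (\<lambda>X. of_bool (bad q (\<lambda>F. F) X))"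
    by (rule bern_exp_mono) (use pk kh k bad in auto)
  also have "\<dots> \<le> ((1/3) ^ q) ^ k * real l ^ q / real q ^ q"
  proof -
    have "(real (card ?F) * real q ^ q) * bern_exp R (\<lambda>_. 1 - (1 - h1) ^ k) (\<lambda>W. of_bool (bad q (\<lambda>F. F) W))
      \<le> ((1/3) ^ q) ^ k * (\<Sum>F\<in>?F. real (card F) ^ q)"
      by (rule bad_after_rounds) (auto simp: q_def h1_def)
    also have "\<dots> = real (card ?F) * (((1/3) ^ q) ^ k * real l ^ q)" by (simp add: cF)
    finally have "real (card ?F) * (real q ^ q * bern_exp R (\<lambda>_. 1 - (1 - h1) ^ k) (\<lambda>W. of_bool (bad q (\<lambda>F. F) W)))
      \<le> real (card ?F) * (((1/3) ^ q) ^ k * real l ^ q)" by (simp only: mult.assoc)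
    then have "real q ^ q * bern_exp R (\<lambda>_. 1 - (1 - h1) ^ k) (\<lambda>W. of_bool (bad q (\<lambda>F. F) W)) \<le> ((1/3) ^ q) ^ k * real l ^ q"
      using cp by (simp only: mult_le_cancel_left_pos)
    moreover have "real q ^ q > 0" by (simp add: q_def)
    ultimately show ?thesis by (simp add: pos_le_divide_eq mult.commute)
  qed
  also have "\<dots> \<le> ((1/3) ^ q) ^ k * real l ^ q / 1"
  proof -
    have "1 \<le> real q ^ q" by (intro one_le_power) (simp add: q_def)
    then show ?thesis by (intro divide_left_mono) auto
  qed
  also have "\<dots> = (real l * (1/3) ^ k) ^ q"
    by (simp add: power_mult_distrib power_mult[symmetric] mult.commute)
  also have "\<dots> \<le> (real ?n * (1/3) ^ k) ^ q"
  proof (intro power_mono mult_right_mono)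
    have "1 * l \<le> r * l" using r3 by (intro mult_le_mono1) auto
    then show "real l \<le> real ?n" using l by linarith
  qed auto
  finally show ?thesis unfolding q_def .
qed

text \<open>If no clique meets \<open>Q\<close>, a matching of size \<open>a\<close> would have to fit into
the other vertices, which are too few. The absence of each clique is a decreasing event of probability
\<open>1 - p^m\<close>.\<close>

lemma uncovered_bound:
  assumes p: "0 \<le> p" "p \<le> 1" and Q: "Q \<subseteq> V" "card V < card Q + r * a"
  shows "(1 - p ^ (r choose 2)) ^ (card Q * ((card V - 1) choose (r - 1)))
    \<le> bern_exp E (\<lambda>_. p) (\<lambda>X. of_bool (\<not> has_matching X))"
proof -
  let ?m = "r choose 2"
  have pm: "0 \<le> 1 - p ^ ?m" "1 - p ^ ?m \<le> 1" using p by (auto simp: power_le_one)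
  define RQ where "RQ = {K \<in> R. K \<inter> Q \<noteq> {}}"
  have finQ: "finite Q" using Q finV finite_subset by blast
  have "card RQ \<le> card (\<Union>v\<in>Q. {K \<in> R. v \<in> K})"
    by (intro card_mono) (use finQ finR in \<open>auto simp: RQ_def\<close>)
  also have "\<dots> \<le> (\<Sum>v\<in>Q. card {K \<in> R. v \<in> K})" by (rule card_UN_le[OF finQ])
  also have "\<dots> \<le> (\<Sum>v\<in>Q. (card V - 1) choose (r - 1))"
  proof (rule sum_mono)
    fix v assume v: "v \<in> Q"
    have "card {K \<in> R. v \<in> K} \<le> card (nsets (V - {v}) (r - 1))"
      by (rule card_inj_on_le[where f = "\<lambda>K. K - {v}"])
        (use finV in \<open>auto simp: inj_on_def nsets_def finite_imp_finite_nsets\<close>)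
    also have "\<dots> = (card V - 1) choose (r - 1)" using card_nsets[of "V - {v}" "r - 1"] finV v Q by auto
    finally show "card {K \<in> R. v \<in> K} \<le> (card V - 1) choose (r - 1)" .
  qed
  finally have cRQ: "card RQ \<le> card Q * ((card V - 1) choose (r - 1))" by simp
  have finRQ: "finite RQ" unfolding RQ_def using finR by auto
  have H: "(1 - p ^ ?m) ^ card \<K> \<le> bern_exp E (\<lambda>_. p) (\<lambda>X. of_bool (\<forall>K\<in>\<K>. \<not> pairs K \<subseteq> X))"
    if "finite \<K>" "\<K> \<subseteq> R" for \<K>
    using that
  proof (induction \<K> rule: finite_induct)
    case empty
    then show ?case using bern_exp_const[OF finE] by simp
  next
    case (insert K \<K>)
    have K: "K \<in> R" using insert by auto
    let ?g = "\<lambda>X. of_bool (\<forall>K\<in>\<K>. \<not> pairs K \<subseteq> X) :: real"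
    have "bern_exp E (\<lambda>_. p) (\<lambda>X. of_bool (pairs K \<subseteq> X) * 1) = (\<Prod>d\<in>pairs K. p) * bern_exp E (\<lambda>_. p) (\<lambda>_. 1)"
      by (rule bern_exp_subset_indep[OF finE pairs_subset_E[OF K]]) auto
    then have "bern_exp E (\<lambda>_. p) (\<lambda>X. of_bool (pairs K \<subseteq> X)) = p ^ ?m"
      using card_pairs[OF K] bern_exp_const[OF finE] by simp
    then have one: "bern_exp E (\<lambda>_. p) (\<lambda>X. 1 - of_bool (pairs K \<subseteq> X)) = 1 - p ^ ?m"
      unfolding bern_exp_diff using bern_exp_const[OF finE] by simp
    have "(1 - p ^ ?m) ^ card (insert K \<K>) = (1 - p ^ ?m) * (1 - p ^ ?m) ^ card \<K>"
      using insert.hyps by simp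
    also have "\<dots> \<le> (1 - p ^ ?m) * bern_exp E (\<lambda>_. p) ?g"
      using insert by (intro mult_left_mono pm) auto
    also have "\<dots> = bern_exp E (\<lambda>_. p) (\<lambda>X. 1 - of_bool (pairs K \<subseteq> X)) * bern_exp E (\<lambda>_. p) ?g"
      unfolding one ..
    also have "\<dots> \<le> bern_exp E (\<lambda>_. p) (\<lambda>X. (1 - of_bool (pairs K \<subseteq> X)) * ?g X)"
    proof (rule harris_inequality[OF finE])
      fix X Y :: "'a set set" assume XY: "X \<subseteq> Y"
      show "1 - of_bool (pairs K \<subseteq> Y) \<le> (1 - of_bool (pairs K \<subseteq> X) :: real)" using XY by auto
      have "(\<forall>K\<in>\<K>. \<not> pairs K \<subseteq> Y) \<Longrightarrow> (\<forall>K\<in>\<K>. \<not> pairs K \<subseteq> X)" using XY by blast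
      then show "?g Y \<le> ?g X" by simp
    qed (use p in auto)
    also have "\<dots> = bern_exp E (\<lambda>_. p) (\<lambda>X. of_bool (\<forall>K\<in>insert K \<K>. \<not> pairs K \<subseteq> X))"
      by (rule bern_exp_cong) auto
    finally show ?case .
  qed
  have "(1 - p ^ ?m) ^ (card Q * ((card V - 1) choose (r - 1))) \<le> (1 - p ^ ?m) ^ card RQ"
    by (rule power_decreasing[OF cRQ pm])
  also have "\<dots> \<le> bern_exp E (\<lambda>_. p) (\<lambda>X. of_bool (\<forall>K\<in>RQ. \<not> pairs K \<subseteq> X))"
    by (rule H[OF finRQ]) (auto simp: RQ_def)
  also have "\<dots> \<le> bern_exp E (\<lambda>_. p) (\<lambda>X. of_bool (\<not> has_matching X))"
  proof (rule bern_exp_mono)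
    fix X assume X: "X \<subseteq> E"
    have "\<not> has_matching X" if n: "\<forall>K\<in>RQ. \<not> pairs K \<subseteq> X"
    proof
      assume "has_matching X"
      then obtain M where M: "M \<in> matchings V r a" "M \<subseteq> avail X" by (auto simp: has_matching_def)
      have "\<Union>M \<subseteq> V - Q"
      proof
        fix v assume "v \<in> \<Union>M"
        then obtain K where K: "K \<in> M" "v \<in> K" by auto
        then have "K \<in> R" "pairs K \<subseteq> X" using M(2) X ER_disjoint by (auto simp: avail_def)
        then show "v \<in> V - Q" using n K by (auto simp: RQ_def nsets_def)
      qed
      then have "card (\<Union>M) \<le> card (V - Q)" using finV by (intro card_mono) auto
      also have "\<dots> = card V - card Q" using Q finQ by (simp add: card_Diff_subset)
      finally have "r * a \<le> card V - card Q" using card_Union_matching(1)[OF finV M(1)] by simp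
      moreover have "card Q \<le> card V" using Q finV by (intro card_mono) auto
      ultimately show False using Q by linarith
    qed
    then show "of_bool (\<forall>K\<in>RQ. \<not> pairs K \<subseteq> X) \<le> (of_bool (\<not> has_matching X) :: real)" by auto
  qed (use p in auto)
  finally show ?thesis .
qed

end

lemma prob_phi:
  assumes "r \<ge> 3" "0 \<le> p" "p \<le> 1"
  shows "measure_pmf.prob (binomial_random_graph n p) {G. phi r s G = 0}
    = bern_exp (nsets {1..n} 2) (\<lambda>_. p) (\<lambda>X. of_bool (\<not> clique_matching.has_matching {1..n} r ((n - s) div r) X))"
proof -
  interpret clique_matching "{1..n}" r "(n - s) div r" by unfold_locales (use assms in auto)
  have ph: "phi r s ({1..n}, X) = 0 \<longleftrightarrow> \<not> has_matching X" if X: "X \<subseteq> E" for X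
  proof -
    have K: "K_copies r ({1..n}, X) = avail X"
    proof -
      have "clique K X \<longleftrightarrow> pairs K \<subseteq> X" for K
        by (auto simp: clique_def nsets_2_eq)
      then show ?thesis using X ER_disjoint by (auto simp: K_copies_def avail_def simp del: One_nat_def)
    qed
    let ?S = "{M. M \<subseteq> avail X \<and> disjoint M \<and> card M = (n - s) div r}"
    have S: "?S = {M \<in> matchings {1..n} r ((n - s) div r). M \<subseteq> avail X}"
      by (auto simp: matchings_def avail_def simp del: One_nat_def)
    have "finite ?S" unfolding S using finite_matchings[of "{1..n}" r "(n - s) div r"] by auto
    then have "card ?S = 0 \<longleftrightarrow> ?S = {}" by (rule card_0_eq)
    moreover have "phi r s ({1..n}, X) = card ?S" unfolding phi_def K by (simp del: One_nat_def)
    ultimately have "phi r s ({1..n}, X) = 0 \<longleftrightarrow> ?S = {}" by (simp only:)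
    then show ?thesis unfolding S has_matching_def by blast
  qed
  let ?P = "Pi_pmf E False (\<lambda>_. bernoulli_pmf p)"
  have "measure_pmf.prob (binomial_random_graph n p) {G. phi r s G = 0}
    = measure_pmf.prob ?P {f. phi r s ({1..n}, {e \<in> E. f e}) = 0}"
    unfolding binomial_random_graph_def by (simp add: vimage_def)
  also have "\<dots> = bern_exp E (\<lambda>_. p) (\<lambda>X. of_bool (phi r s ({1..n}, X) = 0))"
    using prob_Pi_bernoulli[OF finE assms(2,3), of "\<lambda>X. phi r s ({1..n}, X) = 0"] .
  also have "\<dots> = bern_exp E (\<lambda>_. p) (\<lambda>X. of_bool (\<not> has_matching X))"
    by (rule bern_exp_cong) (simp only: ph)
  finally show ?thesis .
qed

section \<open>Asymptotics\<close>

text \<open>The first identity makes the expected number of cliques through a vertex equal to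
\<open>r \<mu>_r/n\<close>.\<close>

lemma mu_bounds:
  assumes "n > 0" "r > 0" "0 \<le> p"
  shows "real ((n - 1) choose (r - 1)) * p ^ (r choose 2) = real r * (mu r n p / real n)"
    and "mu r n p / real n \<le> real n ^ (r - 1) * p ^ (r choose 2)"
proof -
  obtain n' r' where nr: "n = Suc n'" "r = Suc r'" using assms by (metis gr0_implies_Suc)
  have "r * (n choose r) = n * ((n - 1) choose (r - 1))"
    unfolding nr using Suc_times_binomial_eq[of n' r'] by (simp add: mult.commute)
  then have "real r * real (n choose r) = real n * real ((n - 1) choose (r - 1))"
    by (metis of_nat_mult)
  then have eq: "real ((n - 1) choose (r - 1)) = real r * real (n choose r) / real n"
    using assms by (simp add: field_simps)
  show "real ((n - 1) choose (r - 1)) * p ^ (r choose 2) = real r * (mu r n p / real n)"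
    unfolding eq mu_def by simp
  have "n choose r \<le> n ^ r" by (cases "r \<le> n") (auto intro: binomial_le_pow simp: not_le binomial_eq_0)
  then have "real (n choose r) \<le> real (n ^ r)" by (rule of_nat_mono)
  also have "\<dots> = real n * real n ^ (r - 1)" using assms by (cases r) auto
  finally have "real (n choose r) / real n \<le> real n ^ (r - 1)"
    using assms by (simp add: field_simps)
  then have "real (n choose r) / real n * p ^ (r choose 2) \<le> real n ^ (r - 1) * p ^ (r choose 2)"
    using assms by (intro mult_right_mono) auto
  then show "mu r n p / real n \<le> real n ^ (r - 1) * p ^ (r choose 2)"
    unfolding mu_def by simp
qed

lemma one_minus_power_lower:
  fixes x :: real
  assumes "0 \<le> x" "x \<le> 1 / 2"
  shows "exp (- 2 * (x * real N)) \<le> (1 - x) ^ N"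
proof -
  have "- (2 * x) \<le> - x - 2 * x\<^sup>2"
    using assms mult_left_mono[of x "1/2" x] by (simp add: power2_eq_square)
  also have "\<dots> \<le> ln (1 - x)" using ln_one_minus_pos_lower_bound[OF assms] .
  finally have "exp (- (2 * x)) \<le> exp (ln (1 - x))" by simp
  then have "exp (- (2 * x)) \<le> 1 - x" using assms by simp
  then have "exp (- (2 * x)) ^ N \<le> (1 - x) ^ N" by (intro power_mono) auto
  moreover have "exp (- (2 * x)) ^ N = exp (- 2 * (x * real N))"
    using exp_of_nat_mult[of N "- (2 * x)"] by (simp add: algebra_simps)
  ultimately show ?thesis by simp
qed

lemma prob_phi_lower:
  assumes r: "r \<ge> 3" and p: "0 \<le> p" "p \<le> 1 / 2" and s: "s + 1 \<le> n" "r dvd n - s"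
  shows "exp (- (2 * real r * ((real s + 1) * (mu r n p / real n))))
    \<le> measure_pmf.prob (binomial_random_graph n p) {G. phi r s G = 0}"
proof -
  interpret clique_matching "{1..n}" r "(n - s) div r" by unfold_locales (use r in auto)
  let ?m = "r choose 2"
  have "3 choose 2 \<le> ?m" by (rule binomial_right_mono) (use r in auto)
  then have m: "?m \<ge> 1" by (simp add: numeral_eq_Suc)
  have "p ^ ?m \<le> p ^ 1" using p m by (intro power_decreasing) auto
  then have pm: "0 \<le> p ^ ?m" "p ^ ?m \<le> 1 / 2" using p by auto
  have "(1 - p ^ ?m) ^ (card {1..s+1} * ((card {1..n} - 1) choose (r - 1)))
    \<le> bern_exp E (\<lambda>_. p) (\<lambda>X. of_bool (\<not> has_matching X))"
    by (rule uncovered_bound) (use p s in auto)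
  also have "\<dots> = measure_pmf.prob (binomial_random_graph n p) {G. phi r s G = 0}"
    by (rule prob_phi[symmetric]) (use r p in auto)
  finally have 1: "(1 - p ^ ?m) ^ ((s + 1) * ((n - 1) choose (r - 1)))
     \<le> measure_pmf.prob (binomial_random_graph n p) {G. phi r s G = 0}" by simp
  have "p ^ ?m * real ((s + 1) * ((n - 1) choose (r - 1))) = (real s + 1) * (real ((n - 1) choose (r - 1)) * p ^ ?m)"
    unfolding of_nat_mult by simp
  also have "\<dots> = real r * ((real s + 1) * (mu r n p / real n))"
    using mu_bounds(1)[of n r p] r s p by simp
  finally have "- 2 * (p ^ ?m * real ((s + 1) * ((n - 1) choose (r - 1)))) = - (2 * real r * ((real s + 1) * (mu r n p / real n)))"
    by simp
  then show ?thesis using one_minus_power_lower[OF pm, of "(s + 1) * ((n - 1) choose (r - 1))"] 1 by simp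
qed

text \<open>With \<open>B\<close> as the normalised density of a round, the hypergraph of density
\<open>p^m/4\<close> contains \<open>k = \<lfloor>x\<rfloor>\<close> rounds, where
\<open>x = n^(r-1) p^m / (4 B)\<close>. The lower bound on the density gives
\<open>x \<ge> 4 ln n\<close>, so that half of the gain \<open>3^(-k)\<close> pays for the factor
\<open>n\<close>.\<close>

lemma prob_phi_upper:
  fixes p :: real
  defines "B \<equiv> \<lambda>r :: nat. 2304 * (fact r * 3 ^ r) :: real"
  assumes r: "r \<ge> 3" and p: "0 \<le> p" "p \<le> 1 / 2" and s: "s + 1 \<le> n" "r dvd n - s"
    and \<kappa>: "real r * 2 ^ (r * r) * (real n * sqrt (2 * p) ^ (r + 1)) \<le> 1 / 2"
    and n: "B r \<le> real n" "1 \<le> ln (real n)"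
    and dense: "16 * B r * ln (real n) \<le> real n ^ (r - 1) * p ^ (r choose 2)"
  shows "measure_pmf.prob (binomial_random_graph n p) {G. phi r s G = 0}
    \<le> exp (- (1 / (8 * B r * real r) * ((real s + 1) * (mu r n p / real n))))"
proof -
  define a where "a = (n - s) div r"
  interpret clique_matching "{1..n}" r a by unfold_locales (use r in auto)
  let ?m = "r choose 2"
  define lam where "lam = real n ^ (r - 1) * p ^ ?m"
  define l where "l = n div r"
  define q where "q = l - a + 1"
  define h1 where "h1 = B r / real n ^ (r - 1)"
  define x where "x = lam / (4 * B r)"
  define k where "k = nat \<lfloor>x\<rfloor>"
  have B: "B r > 0" unfolding B_def by simp
  have n0: "n > 0" using s by simp
  have nr: "real n \<le> real n ^ (r - 1)"
    using power_increasing[of 1 "r - 1" "real n"] n0 r by simp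
  have h1: "0 < h1" "h1 \<le> 1"
  proof -
    show "0 < h1" unfolding h1_def using B n0 by simp
    show "h1 \<le> 1" unfolding h1_def 
      using order_trans[OF n(1) nr] n0 by (simp add: divide_le_eq_1)
  qed
  have h1': "2304 * (fact r * 3 ^ r / real (card {1..n}) ^ (r - 1)) = h1"
    by (simp add: h1_def B_def)
  have ra: "r * a = n - s" using s(2) by (simp add: a_def)
  have al: "a \<le> l" unfolding a_def l_def by (intro div_le_mono) simp
  have rl: "r * l \<le> n" unfolding l_def by simp
  have qs: "s + 1 \<le> r * q"
  proof -
    have "n < r * l + r" unfolding l_def using r mult_div_mod_eq[of r n] mod_less_divisor[of r n] by linarith
    then have "s + 1 \<le> r * l + r - r * a" using ra s(1) by linarith
    also have "\<dots> = r * q" unfolding q_def using al by (simp add: algebra_simps)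
    finally show ?thesis .
  qed
  have x0: "0 \<le> x" unfolding x_def lam_def using B p by simp
  have kx: "real k \<le> x" "x - 1 \<le> real k" unfolding k_def using x0 by (auto simp: of_nat_nat)
  have kh: "real k * h1 \<le> p ^ ?m / 4"
  proof -
    have "real k * h1 \<le> x * h1" using kx h1 by (intro mult_right_mono) auto
    also have "\<dots> = p ^ ?m / 4" unfolding x_def h1_def lam_def using B n0 by simp
    finally show ?thesis .
  qed
  have pm: "p ^ ?m / 4 \<le> 1"
  proof -
    have "p ^ ?m \<le> 1" using p by (intro power_le_one) auto
    then show ?thesis by simp
  qed
  have "measure_pmf.prob (binomial_random_graph n p) {G. phi r s G = 0} = bern_exp E (\<lambda>_. p) (\<lambda>X. of_bool (\<not> has_matching X))"
    unfolding a_def by (rule prob_phi) (use r p in auto)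
  also have "\<dots> \<le> bern_exp R (\<lambda>_. p ^ ?m / 4) (\<lambda>X. of_bool (\<not> has_matching X))"
    by (rule clique_comparison[of p "sqrt (2 * p)"]) (use p \<kappa> in auto)
  also have "\<dots> \<le> (real (card {1..n}) * (1/3) ^ k) ^ (l - a + 1)"
    by (rule hypergraph_bound) (use n0 rl al h1 kh pm h1' in auto)
  also have "\<dots> = (real n * (1/3) ^ k) ^ q" by (simp add: q_def)
  also have "\<dots> \<le> exp (- (x / 2)) ^ q"
  proof (rule power_mono)
    have "(1/3 :: real) ^ k \<le> exp (- 1) ^ k"
    proof (rule power_mono)
      have "exp (1::real) \<le> 3" by (rule exp_le)
      then show "1 / 3 \<le> exp (- 1 :: real)" by (simp add: exp_minus field_simps)
    qed simp
    also have "exp (- 1 :: real) ^ k = exp (- real k)" using exp_of_nat_mult[of k "- 1 :: real"] by simp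
    finally have "real n * (1/3) ^ k \<le> real n * exp (- real k)" by (intro mult_left_mono) auto
    also have "\<dots> = exp (ln (real n) - real k)" using n0 by (simp add: exp_diff exp_minus field_simps)
    also have "\<dots> \<le> exp (- (x / 2))"
    proof -
      have "4 * ln (real n) \<le> x" using dense B unfolding x_def lam_def by (simp add: field_simps)
      then show ?thesis using kx(2) n(2) by simp
    qed
    finally show "real n * (1/3) ^ k \<le> exp (- (x / 2))" .
  qed simp
  also have "\<dots> = exp (- (real q * (x / 2)))" using exp_of_nat_mult[of q "- (x / 2)"] by simp
  also have "\<dots> \<le> exp (- (1 / (8 * B r * real r) * ((real s + 1) * (mu r n p / real n))))"
  proof -
    have rp: "real r > 0" using r by simp
    have mu0: "0 \<le> mu r n p / real n" unfolding mu_def using p by simp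
    have "(real s + 1) / real r \<le> real q"
    proof -
      have "real (s + 1) \<le> real (r * q)" using qs by (rule of_nat_mono)
      then show ?thesis using rp by (simp add: field_simps)
    qed
    moreover have "mu r n p / real n / (8 * B r) \<le> x / 2"
      using mu_bounds(2)[of n r p] n0 r p B unfolding x_def lam_def by (simp add: field_simps)
    moreover have "0 \<le> mu r n p / real n / (8 * B r)" 
      by (rule divide_nonneg_nonneg[OF mu0]) (use B in simp)
    ultimately have "(real s + 1) / real r * (mu r n p / real n / (8 * B r)) \<le> real q * (x / 2)"
      by (intro mult_mono) simp_all
    then show ?thesis by (simp add: field_simps)
  qed
  finally show ?thesis .
qed

lemma powr_power_half:
  fixes x :: real
  assumes "0 \<le> x"
  shows "sqrt x ^ (r + 1) = x powr ((real r + 1) / 2)"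
proof (cases "x = 0")
  case False
  then have "sqrt x ^ (r + 1) = (x powr (1/2)) powr real (r + 1)"
    using assms by (simp add: powr_half_sqrt powr_realpow del: of_nat_add of_nat_Suc)
  also have "\<dots> = x powr ((real r + 1) / 2)" unfolding powr_powr by (simp add: add.commute)
  finally show ?thesis .
qed simp

text \<open>The assumption on \<open>p\<close> is
\<open>n (2 p)^((r+1)/2) \<le> (2 \<delta>)^((r+1)/2)\<close>, which is at most
\<open>2 \<delta>\<close>; this value of \<open>\<delta>\<close> turns it into the smallness assumption of
\<open>clique_comparison\<close>.\<close>

lemma sparse_condition:
  assumes r: "r \<ge> 3" and p: "0 \<le> p" and n: "n > 0"
    and \<delta>: "\<delta> = 1 / (4 * real r * 2 ^ (r * r))" and up: "p \<le> \<delta> * real n powr (- 2 / (real r + 1))"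
  shows "real r * 2 ^ (r * r) * (real n * sqrt (2 * p) ^ (r + 1)) \<le> 1 / 2" "p \<le> 1 / 2"
proof -
  have D: "real r * 2 ^ (r * r) \<ge> 1"
  proof -
    have "1 * 1 \<le> real r * 2 ^ (r * r)" using r by (intro mult_mono) auto
    then show ?thesis by simp
  qed
  have d: "0 < \<delta>" "2 * \<delta> \<le> 1 / 2" unfolding \<delta> using D by (auto simp: field_simps)
  have e: "real n powr (- 2 / (real r + 1)) \<le> real n powr 0" using n by (intro powr_mono) auto
  then have "\<delta> * real n powr (- 2 / (real r + 1)) \<le> \<delta> * 1" using d n by (intro mult_left_mono) auto
  then show "p \<le> 1 / 2" using up d by linarith
  have "sqrt (2 * p) ^ (r + 1) = (2 * p) powr ((real r + 1) / 2)"
    by (rule powr_power_half) (use p in auto)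
  also have "\<dots> \<le> (2 * \<delta> * real n powr (- 2 / (real r + 1))) powr ((real r + 1) / 2)"
    by (rule powr_mono2) (use p up in auto)
  also have "\<dots> = (2 * \<delta>) powr ((real r + 1) / 2) * real n powr (- 1)"
  proof -
    have "- 2 / (real r + 1) * ((real r + 1) / 2) = - 1" by (simp add: field_simps)
    then have "(real n powr (- 2 / (real r + 1))) powr ((real r + 1) / 2) = real n powr (- 1)"
      unfolding powr_powr by (simp only:)
    then show ?thesis using d n by (simp only: powr_mult) 
  qed
  also have "\<dots> \<le> (2 * \<delta>) powr 1 * real n powr (- 1)"
  proof (intro mult_right_mono powr_mono')
    show "1 \<le> (real r + 1) / 2" using r by simp
  qed (use d in auto)
  also have "\<dots> = 2 * \<delta> / real n" using d n by (simp add: powr_minus_divide)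
  finally have "real n * sqrt (2 * p) ^ (r + 1) \<le> 2 * \<delta>" using n by (simp add: field_simps)
  then have "real r * 2 ^ (r * r) * (real n * sqrt (2 * p) ^ (r + 1)) \<le> real r * 2 ^ (r * r) * (2 * \<delta>)"
    by (intro mult_left_mono) auto
  also have "\<dots> = 1 / 2" unfolding \<delta> using r by simp
  finally show "real r * 2 ^ (r * r) * (real n * sqrt (2 * p) ^ (r + 1)) \<le> 1 / 2" .
qed

text \<open>The \<open>m\<close>-th power of the threshold \<open>n^(-2/r) (ln n)^(1/m)\<close> is
\<open>n^(-(r-1)) ln n\<close>, because \<open>2 m = r (r - 1)\<close>.\<close>

lemma dense_condition:
  assumes r: "r \<ge> 3" and p: "0 \<le> p" and n: "n > 0" "1 \<le> ln (real n)"
    and e: "0 < e" "e \<le> 1"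
    and low: "real n powr (- 2 / real r) * ln (real n) powr (1 / real (r choose 2)) \<le> e * p"
  shows "ln (real n) / e \<le> real n ^ (r - 1) * p ^ (r choose 2)"
proof -
  let ?m = "r choose 2"
  have "3 choose 2 \<le> ?m" by (rule binomial_right_mono) (use r in auto)
  then have m: "?m \<ge> 1" by (simp add: numeral_eq_Suc)
  have m2: "2 * real ?m = real r * (real r - 1)"
  proof -
    have "2 * ?m = r * (r - 1)" using choose_two[of r] by (cases r) auto
    then have "real (2 * ?m) = real (r * (r - 1))" by (rule arg_cong)
    then show ?thesis using r by (simp add: of_nat_diff)
  qed
  let ?L = "real n powr (- 2 / real r) * ln (real n) powr (1 / real ?m)"
  have "?L ^ ?m = real n powr (- (real r - 1)) * ln (real n)"
  proof -
    have "0 < ln (real n)" using n by linarith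
    then have "0 < ?L" using n by (intro mult_pos_pos) simp_all
    then have "?L ^ ?m = ?L powr real ?m" by (rule powr_realpow[symmetric])
    also have "\<dots> = real n powr (- 2 / real r * real ?m) * ln (real n) powr (1 / real ?m * real ?m)"
      using n by (simp add: powr_mult powr_powr)
    also have "- 2 / real r * real ?m = - (real r - 1)" using m2 r by (simp add: field_simps)
    also have "1 / real ?m * real ?m = 1" using r by simp
    also have "ln (real n) powr 1 = ln (real n)" using n by (intro powr_one) linarith
    finally show ?thesis .
  qed
  also have "real n powr (- (real r - 1)) = 1 / real n ^ (r - 1)"
  proof -
    have "real n powr (real r - 1) = real n ^ (r - 1)"
      using powr_realpow[of "real n" "r - 1"] n r by (simp add: of_nat_diff)
    then show ?thesis unfolding powr_minus_divide by (simp only:)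
  qed
  finally have "ln (real n) / real n ^ (r - 1) = ?L ^ ?m" by simp
  also have "\<dots> \<le> (e * p) ^ ?m" using low n by (intro power_mono) auto
  also have "\<dots> = e ^ ?m * p ^ ?m" by (rule power_mult_distrib)
  also have "\<dots> \<le> e ^ 1 * p ^ ?m"
    using e m p by (intro mult_right_mono power_decreasing) auto
  finally show ?thesis using n e by (simp add: field_simps)
qed

theorem theorem1p1:
  fixes r :: nat
  assumes "r \<ge> 3"
  shows "\<exists>c>0. \<exists>C>0. \<forall>(p :: nat \<Rightarrow> real) (s :: nat \<Rightarrow> nat).
    (\<forall>n. 0 \<le> p n \<and> p n \<le> 1) \<longrightarrow>
    (\<lambda>n. real n powr (- 2 / real r) * ln (real n) powr (1 / real (r choose 2))) \<in> o(p) \<longrightarrow>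
    p \<in> o(\<lambda>n. real n powr (- 2 / (real r + 1))) \<longrightarrow>
    (\<forall>n. int r dvd int n - int (s n)) \<longrightarrow>
    (\<lambda>n. real (s n)) \<in> o(\<lambda>n. real n) \<longrightarrow>
    (\<forall>\<^sub>F n in sequentially. \<exists>\<theta>.
       c * ((real (s n) + 1) * (mu r n (p n) / real n)) \<le> \<theta> \<and>
       \<theta> \<le> C * ((real (s n) + 1) * (mu r n (p n) / real n)) \<and>
       measure_pmf.prob (binomial_random_graph n (p n)) {G. phi r (s n) G = 0} = exp (- \<theta>))"
proof -
  define B :: real where "B = 2304 * (fact r * 3 ^ r)"
  have B: "B \<ge> 1"
  proof -
    have "1 * 1 \<le> (fact r * 3 ^ r :: real)" by (intro mult_mono) (auto simp: fact_ge_1)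
    then show ?thesis unfolding B_def by simp
  qed
  define c where "c = 1 / (8 * B * real r)"
  have c: "c > 0" unfolding c_def using B assms by simp
  have C: "2 * real r > 0" using assms by simp
  have main: "\<forall>\<^sub>F n in sequentially. \<exists>\<theta>.
       c * ((real (s n) + 1) * (mu r n (p n) / real n)) \<le> \<theta> \<and>
       \<theta> \<le> (2 * real r) * ((real (s n) + 1) * (mu r n (p n) / real n)) \<and>
       measure_pmf.prob (binomial_random_graph n (p n)) {G. phi r (s n) G = 0} = exp (- \<theta>)"
    if p01: "\<forall>n. 0 \<le> p n \<and> p n \<le> 1"
      and low: "(\<lambda>n. real n powr (- 2 / real r) * ln (real n) powr (1 / real (r choose 2))) \<in> o(p)"
      and up: "p \<in> o(\<lambda>n. real n powr (- 2 / (real r + 1)))"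
      and dv: "\<forall>n. int r dvd int n - int (s n)"
      and so: "(\<lambda>n. real (s n)) \<in> o(\<lambda>n. real n)"
    for p :: "nat \<Rightarrow> real" and s :: "nat \<Rightarrow> nat"
  proof -
    define \<delta> :: real where "\<delta> = 1 / (4 * real r * 2 ^ (r * r))"
    define e where "e = 1 / (16 * B)"
    have \<delta>: "\<delta> > 0" unfolding \<delta>_def using assms by simp
    have e: "0 < e" "e \<le> 1" unfolding e_def using B by auto
    have E1: "\<forall>\<^sub>F n in sequentially. norm (p n) \<le> \<delta> * norm (real n powr (- 2 / (real r + 1)))"
      by (rule landau_o.smallD[OF up \<delta>])
    have E2: "\<forall>\<^sub>F n in sequentially. norm (real n powr (- 2 / real r) * ln (real n) powr (1 / real (r choose 2))) \<le> e * norm (p n)"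
      by (rule landau_o.smallD[OF low e(1)])
    have E3: "\<forall>\<^sub>F n in sequentially. norm (real (s n)) \<le> (1 / 2) * norm (real n)"
      by (rule landau_o.smallD[OF so]) simp
    have E4: "\<forall>\<^sub>F n in sequentially. max (max B 2) (exp 1) \<le> real n"
      using filterlim_real_sequentially unfolding filterlim_at_top by blast
    show ?thesis using E1 E2 E3 E4
    proof eventually_elim
      case (elim n)
      have n: "n \<ge> 2" "B \<le> real n" "exp 1 \<le> real n" using elim(4) by auto
      have lnn: "1 \<le> ln (real n)" using n(3) by (metis exp_gt_zero ln_exp ln_mono)
      have pn: "0 \<le> p n" "p n \<le> 1" using p01 by auto
      have s1: "s n + 1 \<le> n" using elim(3) n(1) by auto
      have dvd: "r dvd n - s n"
        using dv[rule_format, of n] s1 by (metis add_leD1 int_dvd_int_iff of_nat_diff)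
      have up': "p n \<le> \<delta> * real n powr (- 2 / (real r + 1))" using elim(1) pn by simp
      have low': "real n powr (- 2 / real r) * ln (real n) powr (1 / real (r choose 2)) \<le> e * p n"
        using elim(2) pn by simp
      have n0: "n > 0" using n by simp
      note sp = sparse_condition[OF assms pn(1) n0 \<delta>_def up']
      have dens: "16 * B * ln (real n) \<le> real n ^ (r - 1) * p n ^ (r choose 2)"
        using dense_condition[OF assms pn(1) n0 lnn e low'] by (simp add: e_def mult.commute mult.assoc)
      let ?P = "measure_pmf.prob (binomial_random_graph n (p n)) {G. phi r (s n) G = 0}"
      let ?x = "(real (s n) + 1) * (mu r n (p n) / real n)"
      have lower: "exp (- (2 * real r * ?x)) \<le> ?P"
        by (rule prob_phi_lower) (use assms pn sp s1 dvd in auto)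
      have upper: "?P \<le> exp (- (c * ?x))"
        unfolding c_def B_def
        by (rule prob_phi_upper[OF assms pn(1) sp(2) s1 dvd sp(1)])
          (use n lnn dens in \<open>simp_all only: B_def\<close>)
      have P0: "?P > 0" using lower exp_gt_zero less_le_trans by blast
      have "- (2 * real r * ?x) \<le> ln ?P" using lower P0 by (metis exp_gt_zero ln_exp ln_le_cancel_iff)
      moreover have "ln ?P \<le> - (c * ?x)" using upper P0 by (metis exp_gt_zero ln_exp ln_le_cancel_iff)
      moreover have "?P = exp (- (- ln ?P))" using P0 by simp
      ultimately show ?case by (intro exI[of _ "- ln ?P"]) auto
    qed
  qed
  show ?thesis using c C main by blast
qed

end
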